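(* Let $n\ge 2$ be an integer. For a real number $\gamma$, consider the biquadratic form \[ F_\gamma(P,Q)=(2+\gamma)\Big(\|P\|^2\|Q\|^2-\mathrm{trace}^2(P^TQ)\Big)-\|PQ-QP\|^2 \] in the $2n^2$ entries of two real $n\times n$ matrices $P,Q$, where $\|\cdot\|$ is the Frobenius norm. Then the minimum value of $\gamma$ for which $F_\gamma$ is a sum of squares of real polynomials in the entries of $P$ and $Q$ is \[ \gamma_n=\frac{n-2}{2}. \]
   Context: A polynomial is a sum of squares (sos) if it can be written as a finite sum of squares of real polynomials. For $\gamma=0$ the form $F_0$ is the Böttcher–Wenzel form, which is known to be nonnegative. *)

theory Defs
  imports "HOL-Analysis.Analysis"
begin

text \<open>Over the reals a polynomial is determined by its values, so polynomials in the coordinates of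
  a finite-dimensional space are represented by the polynomial functions on that space.\<close>

definition is_sos :: "('a::euclidean_space \<Rightarrow> real) \<Rightarrow> bool" where
  "is_sos f \<longleftrightarrow>
     (\<exists>qs. (\<forall>q\<in>set qs. real_polynomial_function q) \<and> f = (\<lambda>x. \<Sum>q\<leftarrow>qs. (q x)\<^sup>2))"

text \<open>The norm of \<^typ>\<open>real ^ 'n ^ 'n\<close> is the Euclidean norm of the vector of all entries,
  i.e. the Frobenius norm.\<close>

definition BW_form :: "real \<Rightarrow> (real ^ 'n ^ 'n) \<times> (real ^ 'n ^ 'n) \<Rightarrow> real" where
  "BW_form \<gamma> = (\<lambda>(P, Q).
     (2 + \<gamma>) * ((norm P)\<^sup>2 * (norm Q)\<^sup>2 - (trace (transpose P ** Q))\<^sup>2)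
       - (norm (P ** Q - Q ** P))\<^sup>2)"

end

theory Submission
  imports Defs
begin

text \<open>
  Split \<open>P = S + K\<close> and \<open>Q = T + L\<close> into symmetric and skew parts. The form depends only on the
  bivector \<open>P \<and> Q\<close>, as a quadratic form in which it may be changed by the Pluecker relations. One of
  them rewrites \<open>\<langle>[S,T], [K,L]\<rangle>\<close> as a quadratic form in \<open>u = S \<otimes> L - T \<otimes> K\<close> and thereby decouples the
  components \<open>S \<and> T\<close>, \<open>K \<and> L\<close> and \<open>u\<close>. Each of the three remaining quadratic forms is positive
  semidefinite for \<open>2 + \<gamma> = (n + 2) / 2\<close>; completing squares amounts to subtracting from the tensor
  its projection onto the image of the adjoint of the contraction \<open>u \<mapsto> (\<Sum>\<^sub>b u\<^sub>a\<^sub>b\<^sub>b\<^sub>d)\<^sub>a\<^sub>d\<close>.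

  Conversely, in a representation of the form as a sum of squares only the quadratic parts of the
  summands matter, and these are alternating bilinear forms \<open>b\<close>. With \<open>e\<^sub>i\<^sub>j = E\<^sub>i\<^sub>j + E\<^sub>j\<^sub>i\<close>, the
  functional \<open>b \<mapsto> \<Sum>\<^sub>i\<^sub>j (\<Sum>\<^sub>k b(e\<^sub>i\<^sub>k, e\<^sub>k\<^sub>j))\<^sup>2\<close> depends on \<open>b\<^sup>2\<close> only, because rotating the
  4-cycle \<open>i, k, j, l\<close> turns it into a sum of polarizations of \<open>b\<^sup>2\<close>. Evaluated on the whole form it gives
  \<open>2 n (n - 1) (n + 2) (2 (2 + \<gamma>) - (n + 2)) \<ge> 0\<close>.
\<close>

subsection \<open>Sums of squares\<close>

lemma is_sos_square: "real_polynomial_function q \<Longrightarrow> is_sos (\<lambda>x. (q x)\<^sup>2)"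
  unfolding is_sos_def by (intro exI[of _ "[q]"]) auto

lemma is_sos_zero: "is_sos (\<lambda>x. 0)"
  unfolding is_sos_def by (intro exI[of _ "[]"]) auto

lemma is_sos_add:
  assumes "is_sos f" "is_sos g"
  shows "is_sos (\<lambda>x. f x + g x)"
proof -
  obtain ps qs where "\<forall>q\<in>set ps. real_polynomial_function q" "f = (\<lambda>x. \<Sum>q\<leftarrow>ps. (q x)\<^sup>2)"
    "\<forall>q\<in>set qs. real_polynomial_function q" "g = (\<lambda>x. \<Sum>q\<leftarrow>qs. (q x)\<^sup>2)"
    using assms unfolding is_sos_def by metis
  then show ?thesis
    unfolding is_sos_def by (intro exI[of _ "ps @ qs"]) auto
qed

lemma is_sos_cmult:
  assumes "k \<ge> 0" "is_sos f"
  shows "is_sos (\<lambda>x. k * f x)"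
proof -
  obtain ps where ps: "\<forall>q\<in>set ps. real_polynomial_function q" "f = (\<lambda>x. \<Sum>q\<leftarrow>ps. (q x)\<^sup>2)"
    using assms unfolding is_sos_def by metis
  show ?thesis
    unfolding is_sos_def using ps \<open>k \<ge> 0\<close>
    by (intro exI[of _ "map (\<lambda>q x. sqrt k * q x) ps"])
       (auto simp: o_def power_mult_distrib sum_list_const_mult
             intro: real_polynomial_function.intros)
qed

lemma is_sos_sum:
  assumes "\<And>i. i \<in> I \<Longrightarrow> is_sos (f i)"
  shows "is_sos (\<lambda>x. \<Sum>i\<in>I. f i x)"
  using assms by (induction I rule: infinite_finite_induct) (auto intro: is_sos_zero is_sos_add)

subsection \<open>Contractions of four-index tensors\<close>

text \<open>The middle indices are paired so that an outer product of two matrices contracts to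
  their matrix product; a wedge of two matrices then contracts to their commutator.\<close>

definition contract :: "('n::finite \<Rightarrow> 'n \<Rightarrow> 'n \<Rightarrow> 'n \<Rightarrow> real) \<Rightarrow> 'n \<Rightarrow> 'n \<Rightarrow> real" where
  "contract u a d = (\<Sum>b\<in>UNIV. u a b b d)"

text \<open>Up to the factor 4, the adjoint of \<^const>\<open>contract\<close> on the tensors that have parity \<open>s\<close> under
  exchanging the first two indices and parity \<open>r\<close> under exchanging the last two.\<close>

definition lift :: "real \<Rightarrow> real \<Rightarrow> real ^ 'n ^ 'n \<Rightarrow> 'n \<Rightarrow> 'n \<Rightarrow> 'n \<Rightarrow> 'n \<Rightarrow> real" where
  "lift s r X a b c d =
     (if b = c then X $ a $ d else 0) + s * (if a = c then X $ b $ d else 0)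
     + r * (if b = d then X $ a $ c else 0) + s * r * (if a = d then X $ b $ c else 0)"

lemma sum_if_const: "(\<Sum>x\<in>A. if P then f x else 0) = (if P then \<Sum>x\<in>A. f x else 0)"
  by simp

lemma inner_matrix: "(X::real^'n^'n) \<bullet> Y = (\<Sum>a\<in>UNIV. \<Sum>d\<in>UNIV. X $ a $ d * Y $ a $ d)"
  by (simp add: inner_vec_def)

text \<open>The signs \<open>s\<close> and \<open>r\<close> in \<open>lift\<close> are absorbed by
  the parities of \<open>u\<close>: after swapping indices back, each of the four terms becomes the
  same pairing of \<open>contract u\<close> with \<open>X\<close>.\<close>

lemma sum_mult_lift:
  fixes u :: "'n::finite \<Rightarrow> 'n \<Rightarrow> 'n \<Rightarrow> 'n \<Rightarrow> real"
  assumes us: "\<And>a b c d. u b a c d = s * u a b c d"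
    and ur: "\<And>a b c d. u a b d c = r * u a b c d"
  shows "(\<Sum>a\<in>UNIV. \<Sum>b\<in>UNIV. \<Sum>c\<in>UNIV. \<Sum>d\<in>UNIV. u a b c d * lift s r X a b c d)
    = 4 * (\<Sum>a\<in>UNIV. \<Sum>d\<in>UNIV. contract u a d * X $ a $ d)"
proof -
  let ?C = "\<Sum>a\<in>UNIV. \<Sum>d\<in>UNIV. contract u a d * X $ a $ d"
  have C: "?C = (\<Sum>a\<in>UNIV. \<Sum>b\<in>UNIV. \<Sum>d\<in>UNIV. u a b b d * X $ a $ d)"
    unfolding contract_def sum_distrib_right by (intro sum.cong refl sum.swap)
  have 1: "(\<Sum>a\<in>UNIV. \<Sum>b\<in>UNIV. \<Sum>c\<in>UNIV. \<Sum>d\<in>UNIV. u a b c d * (if b = c then X $ a $ d else 0)) = ?C"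
    unfolding C by (simp add: mult_delta_right sum_if_const cong: if_cong)
  have us': "u a b c d * (s * y) = u b a c d * y" for a b c d y
    unfolding us[where a=a and b=b] by (simp only: mult_ac)
  have ur': "u a b c d * (r * y) = u a b d c * y" for a b c d y
    unfolding ur[where c=c and d=d] by (simp only: mult_ac)
  have usr': "u a b c d * (s * r * y) = u b a d c * y" for a b c d y
    unfolding us[where a=a and b=b] ur[where c=c and d=d] by (simp only: mult_ac)
  have "(\<Sum>a\<in>UNIV. \<Sum>b\<in>UNIV. \<Sum>c\<in>UNIV. \<Sum>d\<in>UNIV. u a b c d * (s * (if a = c then X $ b $ d else 0)))
    = (\<Sum>a\<in>UNIV. \<Sum>b\<in>UNIV. \<Sum>d\<in>UNIV. u b a a d * X $ b $ d)"
    unfolding us' by (simp add: mult_delta_right sum_if_const cong: if_cong)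
  also have "\<dots> = ?C"
    unfolding C by (rule sum.swap)
  finally have 2: "(\<Sum>a\<in>UNIV. \<Sum>b\<in>UNIV. \<Sum>c\<in>UNIV. \<Sum>d\<in>UNIV. u a b c d * (s * (if a = c then X $ b $ d else 0))) = ?C" .
  have 3: "(\<Sum>a\<in>UNIV. \<Sum>b\<in>UNIV. \<Sum>c\<in>UNIV. \<Sum>d\<in>UNIV. u a b c d * (r * (if b = d then X $ a $ c else 0))) = ?C"
    unfolding ur' C by (simp add: mult_delta_right cong: if_cong)
  have "(\<Sum>a\<in>UNIV. \<Sum>b\<in>UNIV. \<Sum>c\<in>UNIV. \<Sum>d\<in>UNIV. u a b c d * (s * r * (if a = d then X $ b $ c else 0)))
    = (\<Sum>a\<in>UNIV. \<Sum>b\<in>UNIV. \<Sum>d\<in>UNIV. u b a a d * X $ b $ d)"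
    unfolding usr' by (simp add: mult_delta_right cong: if_cong)
  also have "\<dots> = ?C"
    unfolding C by (rule sum.swap)
  finally have 4: "(\<Sum>a\<in>UNIV. \<Sum>b\<in>UNIV. \<Sum>c\<in>UNIV. \<Sum>d\<in>UNIV. u a b c d * (s * r * (if a = d then X $ b $ c else 0))) = ?C" .
  show ?thesis
    unfolding lift_def distrib_left sum.distrib 1 2 3 4 by simp
qed

text \<open>The vanishing trace removes the only term that is not a multiple of \<open>X\<close>.
  Contraction after lifting is thus a scalar, and \<open>1 / (n + s + r)\<close> is the coefficient
  of the orthogonal projection whenever this scalar is nonzero.\<close>

lemma contract_lift:
  fixes X :: "real ^ 'n ^ 'n"
  assumes "trace X = 0"
  shows "contract (lift s r X) a d = (real CARD('n) + s + r) * X $ a $ d"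
proof -
  have "contract (lift s r X) a d = real CARD('n) * X $ a $ d + s * X $ a $ d + r * X $ a $ d
      + s * r * (if a = d then trace X else 0)"
    unfolding contract_def lift_def trace_def
    by (simp add: sum.distrib flip: sum_distrib_left)
  then show ?thesis using assms by (simp add: algebra_simps)
qed

lemma lift_sym:
  assumes "s * s = 1" "r * r = 1"
  shows "lift s r X b a c d = s * lift s r X a b c d" "lift s r X a b d c = r * lift s r X a b c d"
proof -
  have "s = 1 \<or> s = -1" "r = 1 \<or> r = -1"
    using assms by (simp_all add: square_eq_1_iff)
  then show "lift s r X b a c d = s * lift s r X a b c d" "lift s r X a b d c = r * lift s r X a b c d"
    unfolding lift_def by auto
qed

lemma sum_square_diff4:
  fixes u v :: "'n::finite \<Rightarrow> 'n \<Rightarrow> 'n \<Rightarrow> 'n \<Rightarrow> real"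
  shows "(\<Sum>a\<in>UNIV. \<Sum>b\<in>UNIV. \<Sum>c\<in>UNIV. \<Sum>d\<in>UNIV. (u a b c d - t * v a b c d)\<^sup>2)
    = (\<Sum>a\<in>UNIV. \<Sum>b\<in>UNIV. \<Sum>c\<in>UNIV. \<Sum>d\<in>UNIV. (u a b c d)\<^sup>2)
      - 2 * t * (\<Sum>a\<in>UNIV. \<Sum>b\<in>UNIV. \<Sum>c\<in>UNIV. \<Sum>d\<in>UNIV. u a b c d * v a b c d)
      + t\<^sup>2 * (\<Sum>a\<in>UNIV. \<Sum>b\<in>UNIV. \<Sum>c\<in>UNIV. \<Sum>d\<in>UNIV. v a b c d * v a b c d)"
proof -
  have "(u a b c d - t * v a b c d)\<^sup>2 =
     (u a b c d)\<^sup>2 - 2 * t * (u a b c d * v a b c d) + t\<^sup>2 * (v a b c d * v a b c d)" for a b c d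
    by (simp add: power2_eq_square algebra_simps)
  then show ?thesis
    by (simp only: sum.distrib sum_subtractf sum_distrib_left)
qed

text \<open>The lift has the same parities as \<open>u\<close>, so \<open>sum_mult_lift\<close>
  evaluates both the cross term and the squared norm of the lift. The parameter \<open>t\<close>
  stays free because not every use takes the projection coefficient.\<close>

lemma sum_square_diff_lift:
  fixes u :: "'n::finite \<Rightarrow> 'n \<Rightarrow> 'n \<Rightarrow> 'n \<Rightarrow> real"
  assumes "s * s = 1" "r * r = 1"
    and "\<And>a b c d. u b a c d = s * u a b c d"
    and "\<And>a b c d. u a b d c = r * u a b c d"
    and "trace X = 0"
  shows "(\<Sum>a\<in>UNIV. \<Sum>b\<in>UNIV. \<Sum>c\<in>UNIV. \<Sum>d\<in>UNIV. (u a b c d - t * lift s r X a b c d)\<^sup>2)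
    = (\<Sum>a\<in>UNIV. \<Sum>b\<in>UNIV. \<Sum>c\<in>UNIV. \<Sum>d\<in>UNIV. (u a b c d)\<^sup>2)
      - 8 * t * (\<Sum>a\<in>UNIV. \<Sum>d\<in>UNIV. contract u a d * X $ a $ d)
      + 4 * t\<^sup>2 * (real CARD('n) + s + r) * (X \<bullet> X)"
proof -
  have "(\<Sum>a\<in>UNIV. \<Sum>b\<in>UNIV. \<Sum>c\<in>UNIV. \<Sum>d\<in>UNIV. lift s r X a b c d * lift s r X a b c d)
    = 4 * (\<Sum>a\<in>UNIV. \<Sum>d\<in>UNIV. contract (lift s r X) a d * X $ a $ d)"
    by (rule sum_mult_lift; rule lift_sym[OF assms(1,2)])
  also have "\<dots> = 4 * ((real CARD('n) + s + r) * (X \<bullet> X))"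
    unfolding contract_lift[OF assms(5)] inner_matrix sum_distrib_left by (simp only: mult.assoc)
  finally show ?thesis
    unfolding sum_square_diff4 sum_mult_lift[OF assms(3,4)] by simp
qed

text \<open>Up to the factor 2, the adjoint of the sum of the two contractions \<open>v\<^sub>b\<^sub>a\<^sub>b\<^sub>d\<close> and \<open>v\<^sub>a\<^sub>d\<^sub>b\<^sub>b\<close> on the tensors
  that are skew in the two middle indices.\<close>

definition exchange_lift :: "real ^ 'n ^ 'n \<Rightarrow> 'n \<Rightarrow> 'n \<Rightarrow> 'n \<Rightarrow> 'n \<Rightarrow> real" where
  "exchange_lift X b a e d =
     (if e = d then X $ b $ a else 0) - (if a = d then X $ b $ e else 0)
     + (if b = e then X $ a $ d else 0) - (if a = b then X $ e $ d else 0)"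

text \<open>Skewness pairs up the four terms of \<open>exchange_lift\<close>: the first two each
  give the contraction of the last two indices, the other two each give that of the first and
  third.\<close>

lemma sum_mult_exchange_lift:
  fixes v :: "'n::finite \<Rightarrow> 'n \<Rightarrow> 'n \<Rightarrow> 'n \<Rightarrow> real"
  assumes skew: "\<And>a b d e. v b a e d = - v b e a d"
  shows "(\<Sum>b\<in>UNIV. \<Sum>a\<in>UNIV. \<Sum>e\<in>UNIV. \<Sum>d\<in>UNIV. v b a e d * exchange_lift X b a e d)
    = 2 * (\<Sum>a\<in>UNIV. \<Sum>d\<in>UNIV. ((\<Sum>b\<in>UNIV. v b a b d) + (\<Sum>b\<in>UNIV. v a d b b)) * X $ a $ d)"
proof -
  let ?B = "\<Sum>a\<in>UNIV. \<Sum>d\<in>UNIV. (\<Sum>b\<in>UNIV. v b a b d) * X $ a $ d"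
  let ?C = "\<Sum>a\<in>UNIV. \<Sum>d\<in>UNIV. (\<Sum>b\<in>UNIV. v a d b b) * X $ a $ d"
  have 1: "(\<Sum>b\<in>UNIV. \<Sum>a\<in>UNIV. \<Sum>e\<in>UNIV. \<Sum>d\<in>UNIV. v b a e d * (if e = d then X $ b $ a else 0)) = ?C"
    by (simp add: mult_delta_right sum_distrib_right cong: if_cong)
  have "(\<Sum>b\<in>UNIV. \<Sum>a\<in>UNIV. \<Sum>e\<in>UNIV. \<Sum>d\<in>UNIV. v b a e d * (if a = d then X $ b $ e else 0))
     = (\<Sum>b\<in>UNIV. \<Sum>a\<in>UNIV. \<Sum>e\<in>UNIV. v b a e a * X $ b $ e)"
    by (simp add: mult_delta_right cong: if_cong)
  also have "\<dots> = (\<Sum>b\<in>UNIV. \<Sum>e\<in>UNIV. \<Sum>a\<in>UNIV. v b a e a * X $ b $ e)"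
    by (intro sum.cong refl sum.swap)
  also have "\<dots> = - ?C"
    by (subst skew) (simp add: sum_distrib_right sum_negf)
  finally have 2: "(\<Sum>b\<in>UNIV. \<Sum>a\<in>UNIV. \<Sum>e\<in>UNIV. \<Sum>d\<in>UNIV. v b a e d * (if a = d then X $ b $ e else 0)) = - ?C" .
  have "(\<Sum>b\<in>UNIV. \<Sum>a\<in>UNIV. \<Sum>e\<in>UNIV. \<Sum>d\<in>UNIV. v b a e d * (if b = e then X $ a $ d else 0))
     = (\<Sum>b\<in>UNIV. \<Sum>a\<in>UNIV. \<Sum>d\<in>UNIV. v b a b d * X $ a $ d)"
    by (simp add: mult_delta_right sum_if_const cong: if_cong)
  also have "\<dots> = (\<Sum>a\<in>UNIV. \<Sum>b\<in>UNIV. \<Sum>d\<in>UNIV. v b a b d * X $ a $ d)"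
    by (rule sum.swap)
  also have "\<dots> = ?B"
    unfolding sum_distrib_right by (intro sum.cong refl sum.swap)
  finally have 3: "(\<Sum>b\<in>UNIV. \<Sum>a\<in>UNIV. \<Sum>e\<in>UNIV. \<Sum>d\<in>UNIV. v b a e d * (if b = e then X $ a $ d else 0)) = ?B" .
  have "(\<Sum>b\<in>UNIV. \<Sum>a\<in>UNIV. \<Sum>e\<in>UNIV. \<Sum>d\<in>UNIV. v b a e d * (if a = b then X $ e $ d else 0))
     = (\<Sum>b\<in>UNIV. \<Sum>e\<in>UNIV. \<Sum>d\<in>UNIV. v b b e d * X $ e $ d)"
    by (simp add: mult_delta_right sum_if_const cong: if_cong)
  also have "\<dots> = (\<Sum>e\<in>UNIV. \<Sum>b\<in>UNIV. \<Sum>d\<in>UNIV. v b b e d * X $ e $ d)"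
    by (rule sum.swap)
  also have "\<dots> = (\<Sum>e\<in>UNIV. \<Sum>d\<in>UNIV. \<Sum>b\<in>UNIV. v b b e d * X $ e $ d)"
    by (intro sum.cong refl sum.swap)
  also have "\<dots> = - ?B"
    by (subst skew) (simp add: sum_distrib_right sum_negf)
  finally have 4: "(\<Sum>b\<in>UNIV. \<Sum>a\<in>UNIV. \<Sum>e\<in>UNIV. \<Sum>d\<in>UNIV. v b a e d * (if a = b then X $ e $ d else 0)) = - ?B" .
  show ?thesis
    unfolding exchange_lift_def distrib_left right_diff_distrib sum.distrib sum_subtractf 1 2 3 4 distrib_right by simp
qed

lemma exchange_lift_skew: "exchange_lift X b a e d = - exchange_lift X b e a d"
  unfolding exchange_lift_def by auto

text \<open>Symmetry cancels the two stray copies of \<open>X\<close> and the zero trace removes the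
  diagonal term, so both contractions act as the scalar \<open>n\<close>.\<close>

lemma contract_exchange_lift:
  fixes X :: "real ^ 'n ^ 'n"
  assumes "trace X = 0" "transpose X = X"
  shows "(\<Sum>b\<in>UNIV. exchange_lift X b a b d) = real CARD('n) * X $ a $ d"
    and "(\<Sum>b\<in>UNIV. exchange_lift X a d b b) = real CARD('n) * X $ a $ d"
proof -
  have sym: "X $ i $ j = X $ j $ i" for i j
    using assms(2) by (metis transpose_def vec_lambda_beta)
  have "(\<Sum>b\<in>UNIV. exchange_lift X b a b d) = X $ d $ a - (if a = d then trace X else 0) + real CARD('n) * X $ a $ d - X $ a $ d"
    unfolding exchange_lift_def trace_def by (simp add: sum.distrib sum_subtractf)
  then show "(\<Sum>b\<in>UNIV. exchange_lift X b a b d) = real CARD('n) * X $ a $ d"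
    using assms(1) sym[of a d] by simp
  have "(\<Sum>b\<in>UNIV. exchange_lift X a d b b) = real CARD('n) * X $ a $ d - X $ a $ d + X $ d $ a - (if a = d then trace X else 0)"
    unfolding exchange_lift_def trace_def by (simp add: sum.distrib sum_subtractf)
  then show "(\<Sum>b\<in>UNIV. exchange_lift X a d b b) = real CARD('n) * X $ a $ d"
    using assms(1) sym[of a d] by simp
qed

lemma sum_square_diff_exchange_lift:
  fixes v :: "'n::finite \<Rightarrow> 'n \<Rightarrow> 'n \<Rightarrow> 'n \<Rightarrow> real"
  assumes skew: "\<And>a b d e. v b a e d = - v b e a d"
    and X: "trace X = 0" "transpose X = X"
  shows "(\<Sum>b\<in>UNIV. \<Sum>a\<in>UNIV. \<Sum>e\<in>UNIV. \<Sum>d\<in>UNIV. (v b a e d - t * exchange_lift X b a e d)\<^sup>2)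
    = (\<Sum>b\<in>UNIV. \<Sum>a\<in>UNIV. \<Sum>e\<in>UNIV. \<Sum>d\<in>UNIV. (v b a e d)\<^sup>2)
      - 4 * t * (\<Sum>a\<in>UNIV. \<Sum>d\<in>UNIV. ((\<Sum>b\<in>UNIV. v b a b d) + (\<Sum>b\<in>UNIV. v a d b b)) * X $ a $ d)
      + 4 * t\<^sup>2 * real CARD('n) * (X \<bullet> X)"
proof -
  have "(\<Sum>b\<in>UNIV. \<Sum>a\<in>UNIV. \<Sum>e\<in>UNIV. \<Sum>d\<in>UNIV. exchange_lift X b a e d * exchange_lift X b a e d)
    = 2 * (\<Sum>a\<in>UNIV. \<Sum>d\<in>UNIV. ((\<Sum>b\<in>UNIV. exchange_lift X b a b d) + (\<Sum>b\<in>UNIV. exchange_lift X a d b b)) * X $ a $ d)"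
    by (rule sum_mult_exchange_lift[OF exchange_lift_skew])
  also have "\<dots> = 4 * (real CARD('n) * (X \<bullet> X))"
    unfolding contract_exchange_lift[OF X] inner_matrix sum_distrib_left
    by (intro sum.cong refl) simp
  finally show ?thesis
    unfolding sum_square_diff4 sum_mult_exchange_lift[OF skew] by simp
qed

text \<open>Serves both kinds of tensor: the mixed one \<open>u\<close>, and, with
  \<open>K = S\<close> and \<open>L = T\<close>, the wedge of \<open>S\<close> and \<open>T\<close>,
  where the value is twice their Gram determinant.\<close>

lemma sum_square_outer_diff:
  fixes S T K L :: "real ^ 'n ^ 'n"
  shows "(\<Sum>a\<in>UNIV. \<Sum>b\<in>UNIV. \<Sum>c\<in>UNIV. \<Sum>d\<in>UNIV. (S $ a $ b * L $ c $ d - T $ a $ b * K $ c $ d)\<^sup>2)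
    = (S \<bullet> S) * (L \<bullet> L) + (T \<bullet> T) * (K \<bullet> K) - 2 * (S \<bullet> T) * (L \<bullet> K)"
proof -
  have *: "(\<Sum>a\<in>UNIV. \<Sum>b\<in>UNIV. \<Sum>c\<in>UNIV. \<Sum>d\<in>UNIV. (A $ a $ b * A' $ a $ b) * (B $ c $ d * B' $ c $ d))
     = (A \<bullet> A') * (B \<bullet> B')" for A A' B B' :: "real ^ 'n ^ 'n"
    unfolding inner_matrix sum_distrib_right unfolding sum_distrib_left ..
  have "(S $ a $ b * L $ c $ d - T $ a $ b * K $ c $ d)\<^sup>2 =
    (S $ a $ b * S $ a $ b) * (L $ c $ d * L $ c $ d) + (T $ a $ b * T $ a $ b) * (K $ c $ d * K $ c $ d)
    - 2 * ((S $ a $ b * T $ a $ b) * (L $ c $ d * K $ c $ d))" for a b c d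
    by (simp add: power2_eq_square algebra_simps)
  then show ?thesis
    by (simp only: sum.distrib sum_subtractf sum_distrib_left[symmetric, of 2] *)
qed

section \<open>Adjoints and transposes for the Frobenius inner product\<close>

lemma inner_matrix_mult_left:
  fixes A B C :: "real ^ 'n ^ 'n"
  shows "(A ** B) \<bullet> C = B \<bullet> (transpose A ** C)"
proof -
  have "(A ** B) \<bullet> C = (\<Sum>i\<in>UNIV. \<Sum>j\<in>UNIV. \<Sum>k\<in>UNIV. A $ i $ k * B $ k $ j * C $ i $ j)"
    by (simp add: inner_matrix matrix_matrix_mult_def sum_distrib_right)
  also have "\<dots> = (\<Sum>i\<in>UNIV. \<Sum>k\<in>UNIV. \<Sum>j\<in>UNIV. A $ i $ k * B $ k $ j * C $ i $ j)"
    by (intro sum.cong refl sum.swap)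
  also have "\<dots> = (\<Sum>k\<in>UNIV. \<Sum>i\<in>UNIV. \<Sum>j\<in>UNIV. A $ i $ k * B $ k $ j * C $ i $ j)"
    by (rule sum.swap)
  also have "\<dots> = (\<Sum>k\<in>UNIV. \<Sum>j\<in>UNIV. \<Sum>i\<in>UNIV. A $ i $ k * B $ k $ j * C $ i $ j)"
    by (intro sum.cong refl sum.swap)
  also have "\<dots> = B \<bullet> (transpose A ** C)"
    by (simp add: inner_matrix matrix_matrix_mult_def transpose_def sum_distrib_left mult_ac)
  finally show ?thesis .
qed

lemma inner_transpose:
  fixes A B :: "real ^ 'n ^ 'n"
  shows "transpose A \<bullet> transpose B = A \<bullet> B"
  unfolding inner_matrix transpose_def by (simp, rule sum.swap)

lemma inner_matrix_mult_right:
  fixes A B C :: "real ^ 'n ^ 'n"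
  shows "(A ** B) \<bullet> C = A \<bullet> (C ** transpose B)"
  using inner_matrix_mult_left[of "transpose B" "transpose A" "transpose C"]
  by (metis inner_transpose matrix_transpose_mul transpose_transpose)

lemma trace_transpose_mult: 
  fixes A B :: "real ^ 'n ^ 'n"
  shows "trace (transpose A ** B) = A \<bullet> B"
  unfolding inner_matrix trace_def matrix_matrix_mult_def transpose_def by (simp, rule sum.swap)

text \<open>The indices run around the cycle \<open>b, a, d, e\<close>, so the sum closes up to a
  single inner product of matrix products. Each of the four terms in the exchange sum of
  \<open>u\<close> has this shape.\<close>

lemma sum_exchange:
  fixes S T K L :: "real ^ 'n ^ 'n"
  shows "(\<Sum>b\<in>UNIV. \<Sum>a\<in>UNIV. \<Sum>e\<in>UNIV. \<Sum>d\<in>UNIV. S $ b $ a * L $ e $ d * (T $ b $ e * K $ a $ d))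
     = (transpose T ** S) \<bullet> (L ** transpose K)"
proof -
  have "(\<Sum>b\<in>UNIV. \<Sum>a\<in>UNIV. \<Sum>e\<in>UNIV. \<Sum>d\<in>UNIV. S $ b $ a * L $ e $ d * (T $ b $ e * K $ a $ d))
     = S \<bullet> (T ** (L ** transpose K))"
    unfolding inner_matrix matrix_matrix_mult_def transpose_def
    by (simp add: sum_distrib_left mult_ac)
  also have "\<dots> = (transpose T ** S) \<bullet> (L ** transpose K)"
    using inner_matrix_mult_left[of "transpose T" S] by simp
  finally show ?thesis .
qed

subsection \<open>The sum of squares representation\<close>

abbreviation commutator :: "real ^ 'n ^ 'n \<Rightarrow> real ^ 'n ^ 'n \<Rightarrow> real ^ 'n ^ 'n" where
  "commutator A B \<equiv> A ** B - B ** A"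

lemma trace_scaleR: "trace (c *\<^sub>R A) = c * trace (A :: real ^ 'n ^ 'n)"
  by (simp add: trace_def sum_distrib_left)

lemma trace_transpose: "trace (transpose A) = trace (A :: real ^ 'n ^ 'n)"
  by (simp add: trace_def transpose_def)

lemma transpose_add: "transpose (A + B) = transpose A + transpose (B :: real ^ 'n ^ 'n)"
  by (simp add: transpose_def vec_eq_iff)

lemma transpose_diff: "transpose (A - B) = transpose A - transpose (B :: real ^ 'n ^ 'n)"
  by (simp add: transpose_def vec_eq_iff)

lemma transpose_scaleR: "transpose (c *\<^sub>R A) = c *\<^sub>R transpose (A :: real ^ 'n ^ 'n)"
  by (simp add: transpose_def vec_eq_iff)

lemma transpose_nth: "transpose A $ i $ j = A $ j $ i"
  by (simp add: transpose_def)

lemma matrix_minus_mult: "(- A) ** B = - (A ** (B :: real ^ 'n ^ 'n))"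
  by (simp add: matrix_matrix_mult_def vec_eq_iff sum_negf)

lemma matrix_mult_minus: "A ** (- B) = - (A ** (B :: real ^ 'n ^ 'n))"
  by (simp add: matrix_matrix_mult_def vec_eq_iff sum_negf)

lemma matrix_add_rdistrib: "(A + B) ** C = A ** C + B ** (C :: real ^ 'n ^ 'n)"
  by (simp add: matrix_matrix_mult_def vec_eq_iff distrib_right sum.distrib)

text \<open>Transposition preserves the inner product, but here it also changes its sign.\<close>

lemma inner_sym_skew:
  fixes A B :: "real ^ 'n ^ 'n"
  assumes "transpose A = A" "transpose B = - B"
  shows "A \<bullet> B = 0"
  using inner_transpose[of A B] assms by simp

lemma contract_outer_diff:
  fixes S T K L :: "real ^ 'n ^ 'n"
  shows "contract (\<lambda>a b c d. S $ a $ b * L $ c $ d - T $ a $ b * K $ c $ d) a d = (S ** L - T ** K) $ a $ d"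
  by (simp add: contract_def matrix_matrix_mult_def sum_subtractf)

text \<open>The tensor contracts to the commutator, which is trace-free, so
  \<open>sum_square_diff_lift\<close> applies. The sign \<open>s\<close> treats symmetric and skew
  pairs together.\<close>

lemma wedge_commutator_identity:
  fixes S T :: "real ^ 'n ^ 'n"
  assumes s: "s * s = 1" and S: "transpose S = s *\<^sub>R S" and T: "transpose T = s *\<^sub>R T"
  shows "(\<Sum>a\<in>UNIV. \<Sum>b\<in>UNIV. \<Sum>c\<in>UNIV. \<Sum>d\<in>UNIV.
      (S $ a $ b * T $ c $ d - T $ a $ b * S $ c $ d - t * lift s s (commutator S T) a b c d)\<^sup>2)
    = 2 * ((S \<bullet> S) * (T \<bullet> T) - (S \<bullet> T)\<^sup>2)
      - (8 * t - 4 * t\<^sup>2 * (real CARD('n) + 2 * s)) * (commutator S T \<bullet> commutator S T)"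
proof -
  have S': "S $ b $ a = s * S $ a $ b" and T': "T $ b $ a = s * T $ a $ b" for a b
    using arg_cong[OF S, of "\<lambda>M. M $ a $ b"] arg_cong[OF T, of "\<lambda>M. M $ a $ b"]
    by (simp_all add: transpose_nth)
  have tr: "trace (commutator S T) = 0"
    by (simp add: trace_sub trace_mul_sym[of S T])
  have "(\<Sum>a\<in>UNIV. \<Sum>b\<in>UNIV. \<Sum>c\<in>UNIV. \<Sum>d\<in>UNIV.
      (S $ a $ b * T $ c $ d - T $ a $ b * S $ c $ d - t * lift s s (commutator S T) a b c d)\<^sup>2)
    = (\<Sum>a\<in>UNIV. \<Sum>b\<in>UNIV. \<Sum>c\<in>UNIV. \<Sum>d\<in>UNIV. (S $ a $ b * T $ c $ d - T $ a $ b * S $ c $ d)\<^sup>2)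
      - 8 * t * (\<Sum>a\<in>UNIV. \<Sum>d\<in>UNIV. contract (\<lambda>a b c d. S $ a $ b * T $ c $ d - T $ a $ b * S $ c $ d) a d
          * commutator S T $ a $ d)
      + 4 * t\<^sup>2 * (real CARD('n) + s + s) * (commutator S T \<bullet> commutator S T)"
  proof (rule sum_square_diff_lift[OF s s _ _ tr])
    fix a b c d
    show "S $ b $ a * T $ c $ d - T $ b $ a * S $ c $ d = s * (S $ a $ b * T $ c $ d - T $ a $ b * S $ c $ d)"
      unfolding S'[of b a] T'[of b a] by (simp add: algebra_simps)
    show "S $ a $ b * T $ d $ c - T $ a $ b * S $ d $ c = s * (S $ a $ b * T $ c $ d - T $ a $ b * S $ c $ d)"
      unfolding S'[of d c] T'[of d c] by (simp add: algebra_simps)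
  qed
  also have "\<dots> = 2 * ((S \<bullet> S) * (T \<bullet> T) - (S \<bullet> T)\<^sup>2)
      - (8 * t - 4 * t\<^sup>2 * (real CARD('n) + 2 * s)) * (commutator S T \<bullet> commutator S T)"
    unfolding contract_outer_diff sum_square_outer_diff inner_matrix[symmetric]
    by (simp add: algebra_simps inner_commute power2_eq_square)
  finally show ?thesis .
qed

text \<open>The Pluecker relation enters through the fact \<open>V\<close>: the exchange sum \<open>\<Sum> u\<^sub>b\<^sub>a\<^sub>e\<^sub>d u\<^sub>b\<^sub>e\<^sub>a\<^sub>d\<close> accounts for the
  inner product of the two commutators, which is not a function of \<open>u\<close> on the face of it.\<close>

lemma mixed_identity:
  fixes S T K L :: "real ^ 'n ^ 'n"
  assumes sym: "transpose S = S" "transpose T = T" and skew: "transpose K = - K" "transpose L = - L"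
    and N: "N = S ** L - T ** K" and Y: "Y = (1/2) *\<^sub>R (N + transpose N)"
    and u: "u = (\<lambda>a b c d. S $ a $ b * L $ c $ d - T $ a $ b * K $ c $ d)"
    and n: "n = real CARD('n)"
  shows "(n + 2) / 2 * ((S \<bullet> S) * (L \<bullet> L) + (T \<bullet> T) * (K \<bullet> K) - 2 * (S \<bullet> T) * (L \<bullet> K))
      - 4 * (Y \<bullet> Y) - 2 * (commutator S T \<bullet> commutator K L)
    = (n - 2) / 2 * (\<Sum>a\<in>UNIV. \<Sum>b\<in>UNIV. \<Sum>c\<in>UNIV. \<Sum>d\<in>UNIV. (u a b c d - 1 / n * lift 1 (-1) Y a b c d)\<^sup>2)
    + (\<Sum>b\<in>UNIV. \<Sum>a\<in>UNIV. \<Sum>e\<in>UNIV. \<Sum>d\<in>UNIV. (u b a e d - u b e a d - 1 / n * exchange_lift Y b a e d)\<^sup>2)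
    + 2 * ((N - Y) \<bullet> (N - Y))"
proof -
  have S': "S $ b $ a = S $ a $ b" and T': "T $ b $ a = T $ a $ b"
    and K': "K $ b $ a = - K $ a $ b" and L': "L $ b $ a = - L $ a $ b" for a b
    using arg_cong[OF sym(1), of "\<lambda>M. M $ a $ b"] arg_cong[OF sym(2), of "\<lambda>M. M $ a $ b"]
      arg_cong[OF skew(1), of "\<lambda>M. M $ a $ b"] arg_cong[OF skew(2), of "\<lambda>M. M $ a $ b"]
    by (simp_all add: transpose_nth)
  have n0: "n > 0" unfolding n by simp
  have L0: "L $ a $ a = 0" and K0: "K $ a $ a = 0" for a
    using L'[of a a] K'[of a a] by simp_all
  have symY: "transpose Y = Y"
    unfolding Y by (simp add: transpose_scaleR transpose_add add.commute)
  have trN: "trace (A ** B) = 0" if "transpose A = A" "transpose B = - B" for A B :: "real ^ 'n ^ 'n"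
    using trace_transpose_mult[of A B] inner_sym_skew[of A B] that by simp
  have trY: "trace Y = 0"
    unfolding Y N by (simp add: trace_scaleR trace_add trace_sub trace_transpose trN sym skew)
  \<comment> \<open>\<open>N - Y\<close> is the skew part of \<open>N\<close>, hence orthogonal to
    the symmetric part \<open>Y\<close>.\<close>
  have NY: "N \<bullet> Y = Y \<bullet> Y"
  proof -
    have "transpose (N - Y) = - (N - Y)"
      unfolding Y by (simp add: transpose_scaleR transpose_add transpose_diff vec_eq_iff field_simps transpose_nth)
    then have "Y \<bullet> (N - Y) = 0"
      using inner_sym_skew symY by blast
    then show ?thesis by (simp add: algebra_simps inner_commute)
  qed
  define c where "c = (S \<bullet> S) * (L \<bullet> L) + (T \<bullet> T) * (K \<bullet> K) - 2 * (S \<bullet> T) * (L \<bullet> K)"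
  have usq: "(\<Sum>a\<in>UNIV. \<Sum>b\<in>UNIV. \<Sum>c\<in>UNIV. \<Sum>d\<in>UNIV. (u a b c d)\<^sup>2) = c"
    unfolding u c_def by (rule sum_square_outer_diff)
  have cu: "contract u a d = N $ a $ d" for a d
    unfolding u contract_outer_diff N ..
  have 1: "(\<Sum>a\<in>UNIV. \<Sum>b\<in>UNIV. \<Sum>c\<in>UNIV. \<Sum>d\<in>UNIV. (u a b c d - 1 / n * lift 1 (-1) Y a b c d)\<^sup>2)
     = c - 4 / n * (Y \<bullet> Y)"
  proof -
    have "(\<Sum>a\<in>UNIV. \<Sum>b\<in>UNIV. \<Sum>c\<in>UNIV. \<Sum>d\<in>UNIV. (u a b c d - 1 / n * lift 1 (-1) Y a b c d)\<^sup>2)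
     = (\<Sum>a\<in>UNIV. \<Sum>b\<in>UNIV. \<Sum>c\<in>UNIV. \<Sum>d\<in>UNIV. (u a b c d)\<^sup>2)
      - 8 * (1 / n) * (\<Sum>a\<in>UNIV. \<Sum>d\<in>UNIV. contract u a d * Y $ a $ d)
      + 4 * (1 / n)\<^sup>2 * (real CARD('n) + 1 + (-1)) * (Y \<bullet> Y)"
    proof (rule sum_square_diff_lift[OF _ _ _ _ trY])
      fix a b c d
      show "u b a c d = 1 * u a b c d"
        unfolding u S'[of a b] T'[of a b] by simp
      show "u a b d c = (-1) * u a b c d"
        unfolding u K'[of c d] L'[of c d] by simp
    qed auto
    also have "\<dots> = c - 4 / n * (Y \<bullet> Y)"
      unfolding usq cu inner_matrix[symmetric] NY n[symmetric] using n0
      by (simp add: field_simps power2_eq_square)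
    finally show ?thesis .
  qed
  have 2: "(\<Sum>b\<in>UNIV. \<Sum>a\<in>UNIV. \<Sum>e\<in>UNIV. \<Sum>d\<in>UNIV. (u b a e d - u b e a d - 1 / n * exchange_lift Y b a e d)\<^sup>2)
     = (\<Sum>b\<in>UNIV. \<Sum>a\<in>UNIV. \<Sum>e\<in>UNIV. \<Sum>d\<in>UNIV. (u b a e d - u b e a d)\<^sup>2) - 4 / n * (Y \<bullet> Y)"
  proof -
    \<comment> \<open>The exchange difference contracts to \<open>N - Z\<close> over its first and
      third indices and to \<open>N\<close> over its last two. \<open>Z\<close> inherits skewness
      from \<open>K\<close> and \<open>L\<close>, so it is invisible when paired with
      \<open>Y\<close>.\<close>
    define Z where "Z = (\<chi> a d. \<Sum>b\<in>UNIV. u b b a d)"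
    have Zskew: "transpose Z = - Z"
    proof (intro vec_eq_iff[THEN iffD2] allI)
      fix i j
      have "u b b j i = - u b b i j" for b
        unfolding u K'[of j i] L'[of j i] by simp
      from sum.cong[OF refl this] show "transpose Z $ i $ j = (- Z) $ i $ j"
        by (simp add: Z_def transpose_nth sum_negf)
    qed
    have ZY: "Z \<bullet> Y = 0"
      using inner_sym_skew[OF symY Zskew] by (simp add: inner_commute)
    have c1: "(\<Sum>b\<in>UNIV. u b a b d - u b b a d) = N $ a $ d - Z $ a $ d" for a d
    proof -
      have "u b a b d = u a b b d" for b
        unfolding u S'[of b a] T'[of b a] ..
      then show ?thesis
        unfolding cu[symmetric] contract_def Z_def sum_subtractf by simp
    qed
    have c2: "(\<Sum>b\<in>UNIV. u a d b b - u a b d b) = N $ a $ d" for a d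
    proof -
      have "u a d b b - u a b d b = u a b b d" for b
        unfolding u L0 K0 L'[of d b] K'[of d b] by simp
      then show ?thesis
        unfolding cu[symmetric] contract_def by simp
    qed
    have "(\<Sum>b\<in>UNIV. \<Sum>a\<in>UNIV. \<Sum>e\<in>UNIV. \<Sum>d\<in>UNIV. (u b a e d - u b e a d - 1 / n * exchange_lift Y b a e d)\<^sup>2)
     = (\<Sum>b\<in>UNIV. \<Sum>a\<in>UNIV. \<Sum>e\<in>UNIV. \<Sum>d\<in>UNIV. (u b a e d - u b e a d)\<^sup>2)
      - 4 * (1 / n) * (\<Sum>a\<in>UNIV. \<Sum>d\<in>UNIV. ((\<Sum>b\<in>UNIV. u b a b d - u b b a d) + (\<Sum>b\<in>UNIV. u a d b b - u a b d b)) * Y $ a $ d)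
      + 4 * (1 / n)\<^sup>2 * real CARD('n) * (Y \<bullet> Y)"
      by (rule sum_square_diff_exchange_lift[OF _ trY symY]) simp
    also have "(\<Sum>a\<in>UNIV. \<Sum>d\<in>UNIV. ((\<Sum>b\<in>UNIV. u b a b d - u b b a d) + (\<Sum>b\<in>UNIV. u a d b b - u a b d b)) * Y $ a $ d)
      = (N - Z + N) \<bullet> Y"
      unfolding c1 c2 inner_matrix by simp
    also have "\<dots> = 2 * (Y \<bullet> Y)"
      unfolding inner_add_left inner_diff_left NY ZY by simp
    finally show ?thesis
      unfolding n[symmetric] using n0 by (simp add: field_simps power2_eq_square)
  qed
  define V where "V = (\<Sum>b\<in>UNIV. \<Sum>a\<in>UNIV. \<Sum>e\<in>UNIV. \<Sum>d\<in>UNIV. u b a e d * u b e a d)"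
  have 3: "(\<Sum>b\<in>UNIV. \<Sum>a\<in>UNIV. \<Sum>e\<in>UNIV. \<Sum>d\<in>UNIV. (u b a e d - u b e a d)\<^sup>2) = 2 * c - 2 * V"
  proof -
    have "(\<Sum>b\<in>UNIV. \<Sum>a\<in>UNIV. \<Sum>e\<in>UNIV. \<Sum>d\<in>UNIV. u b e a d * u b e a d) = c"
      unfolding usq[symmetric] power2_eq_square by (intro sum.cong refl sum.swap)
    then show ?thesis
      using sum_square_diff4[of u 1 "\<lambda>b a e d. u b e a d"] usq V_def by simp
  qed
  have V: "V = N \<bullet> N + commutator S T \<bullet> commutator K L"
  proof -
    have "V = (transpose S ** S) \<bullet> (L ** transpose L) - (transpose T ** S) \<bullet> (L ** transpose K)
      - (transpose S ** T) \<bullet> (K ** transpose L) + (transpose T ** T) \<bullet> (K ** transpose K)"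
      unfolding V_def u sum_exchange[symmetric]
      by (simp only: sum.distrib[symmetric] sum_subtractf[symmetric]) (simp add: algebra_simps)
    also have "\<dots> = - ((S ** S) \<bullet> (L ** L)) + (T ** S) \<bullet> (L ** K) + (S ** T) \<bullet> (K ** L) - (T ** T) \<bullet> (K ** K)"
      by (simp add: sym skew matrix_mult_minus)
    finally have V: "V = \<dots>" .
    \<comment> \<open>Moving factors around the cyclic product separates symmetric from skew
      matrices; the sign comes from moving a skew factor. The cross term of
      \<open>N \<bullet> N\<close> occurs twice and is rewritten once by each rule, which produces
      the four products that combine with the commutators to \<open>V\<close>.\<close>
    have a: "(A ** C) \<bullet> (B ** D) = - ((B ** A) \<bullet> (D ** C))" and b: "(A ** C) \<bullet> (B ** D) = - ((A ** B) \<bullet> (C ** D))"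
      if "transpose A = A" "transpose B = B" "transpose C = - C" "transpose D = - D"
      for A B C D :: "real ^ 'n ^ 'n"
    proof -
      have "(A ** C) \<bullet> (B ** D) = ((B ** A) ** C) \<bullet> D"
        using inner_matrix_mult_left[of B D "A ** C"] that by (simp add: matrix_mul_assoc inner_commute)
      then show "(A ** C) \<bullet> (B ** D) = - ((B ** A) \<bullet> (D ** C))"
        using inner_matrix_mult_right[of "B ** A" C D] that by (simp add: matrix_mult_minus)
      have "(A ** C) \<bullet> (B ** D) = ((A ** B) ** D) \<bullet> C"
        using inner_matrix_mult_left[of A C "B ** D"] that by (simp add: matrix_mul_assoc inner_commute)
      then show "(A ** C) \<bullet> (B ** D) = - ((A ** B) \<bullet> (C ** D))"
        using inner_matrix_mult_right[of "A ** B" D C] that by (simp add: matrix_mult_minus)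
    qed
    show ?thesis
      unfolding V N inner_diff_left inner_diff_right
      using a[of S S L L] a[of T T K K] a[of S T L K] b[of S T L K] sym skew
      by (simp add: inner_commute)
  qed
  have 4: "(N - Y) \<bullet> (N - Y) = N \<bullet> N - Y \<bullet> Y"
    using NY by (simp add: algebra_simps inner_commute)
  \<comment> \<open>The term \<open>N \<bullet> N\<close> in \<open>V\<close> cancels against the
    skew part, and the coefficients of \<open>Y \<bullet> Y\<close> add up to
    \<open>2 * (n - 2) / n + 4 / n + 2 = 4\<close>.\<close>
  show ?thesis
    unfolding 1 2 3 4 c_def[symmetric] V using n0 by (simp add: field_simps)
qed

text \<open>The commutator of the sums has skew part \<open>[S,T] + [K,L]\<close> and symmetric part
  \<open>2 *\<^sub>R Y\<close>, which are orthogonal. The one remaining coupling between the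
  symmetric pair and the skew pair is the inner product of their commutators, placed in the mixed
  block.\<close>

lemma BW_form_decomposition:
  fixes S T K L :: "real ^ 'n ^ 'n"
  assumes sym: "transpose S = S" "transpose T = T" and skew: "transpose K = - K" "transpose L = - L"
    and N: "N = S ** L - T ** K" and Y: "Y = (1/2) *\<^sub>R (N + transpose N)"
  shows "BW_form g (S + K, T + L) =
    (2 + g) * ((S \<bullet> S) * (T \<bullet> T) - (S \<bullet> T)\<^sup>2) - commutator S T \<bullet> commutator S T
    + ((2 + g) * ((K \<bullet> K) * (L \<bullet> L) - (K \<bullet> L)\<^sup>2) - commutator K L \<bullet> commutator K L)
    + ((2 + g) * ((S \<bullet> S) * (L \<bullet> L) + (T \<bullet> T) * (K \<bullet> K) - 2 * (S \<bullet> T) * (L \<bullet> K))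
      - 4 * (Y \<bullet> Y) - 2 * (commutator S T \<bullet> commutator K L))"
proof -
  have 0: "S \<bullet> K = 0" "S \<bullet> L = 0" "T \<bullet> K = 0" "T \<bullet> L = 0" "K \<bullet> S = 0" "L \<bullet> S = 0" "K \<bullet> T = 0" "L \<bullet> T = 0"
    by (simp_all add: inner_sym_skew sym skew inner_commute[of K] inner_commute[of L])
  have Nt: "transpose N = K ** T - L ** S"
    unfolding N by (simp add: transpose_diff matrix_transpose_mul sym skew matrix_minus_mult)
  have symY: "transpose Y = Y"
    unfolding Y by (simp add: transpose_scaleR transpose_add add.commute)
  define Z where "Z = commutator S T + commutator K L"
  have "transpose Z = - Z"
    unfolding Z_def
    by (simp add: transpose_add transpose_diff matrix_transpose_mul sym skew matrix_minus_mult matrix_mult_minus)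
  then have YZ: "Y \<bullet> Z = 0"
    using inner_sym_skew symY by blast
  have "commutator (S + K) (T + L) = Z + 2 *\<^sub>R Y"
    unfolding Y Z_def Nt unfolding N by (simp add: matrix_add_ldistrib matrix_add_rdistrib)
  then have "commutator (S + K) (T + L) \<bullet> commutator (S + K) (T + L) = Z \<bullet> Z + 4 * (Y \<bullet> Y)"
    by (simp add: inner_add_left inner_add_right YZ inner_commute[of Z Y])
  also have "Z \<bullet> Z = commutator S T \<bullet> commutator S T + commutator K L \<bullet> commutator K L
      + 2 * (commutator S T \<bullet> commutator K L)"
    unfolding Z_def by (simp only: inner_add_left inner_add_right inner_commute[of "commutator K L" "commutator S T"])
  finally have C: "commutator (S + K) (T + L) \<bullet> commutator (S + K) (T + L) = \<dots> + 4 * (Y \<bullet> Y)" .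
  show ?thesis
    unfolding BW_form_def prod.case power2_norm_eq_inner trace_transpose_mult C
    by (simp add: inner_add_left inner_add_right 0 inner_commute power2_eq_square algebra_simps)
qed

section \<open>Matrices with polynomial entries, and assembly of the squares\<close>

definition polynomial_matrix :: "('a::euclidean_space \<Rightarrow> real ^ 'n ^ 'n) \<Rightarrow> bool" where
  "polynomial_matrix M \<longleftrightarrow> (\<forall>i j. real_polynomial_function (\<lambda>x. M x $ i $ j))"

lemma polynomial_matrixD: "polynomial_matrix M \<Longrightarrow> real_polynomial_function (\<lambda>x. M x $ i $ j)"
  by (simp add: polynomial_matrix_def)

lemma polynomial_matrix_add: "polynomial_matrix M \<Longrightarrow> polynomial_matrix N \<Longrightarrow> polynomial_matrix (\<lambda>x. M x + N x)"
  and polynomial_matrix_diff: "polynomial_matrix M \<Longrightarrow> polynomial_matrix N \<Longrightarrow> polynomial_matrix (\<lambda>x. M x - N x)"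
  and polynomial_matrix_scaleR: "polynomial_matrix M \<Longrightarrow> polynomial_matrix (\<lambda>x. c *\<^sub>R M x)"
  and polynomial_matrix_transpose: "polynomial_matrix M \<Longrightarrow> polynomial_matrix (\<lambda>x. transpose (M x))"
  and polynomial_matrix_mult: "polynomial_matrix M \<Longrightarrow> polynomial_matrix N \<Longrightarrow> polynomial_matrix (\<lambda>x. M x ** N x)"
  unfolding polynomial_matrix_def matrix_matrix_mult_def transpose_def
  by (auto intro!: real_polynomial_function.intros(2-4) real_polynomial_function_diff real_polynomial_function_sum)

lemma polynomial_matrix_linear:
  assumes "bounded_linear M"
  shows "polynomial_matrix M"
  unfolding polynomial_matrix_def
  by (intro allI real_polynomial_function.intros(1) bounded_linear_compose[OF bounded_linear_vec_nth]
      bounded_linear_compose[OF bounded_linear_vec_nth assms])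

text \<open>The condition does not depend on the point; this covers the Kronecker deltas in
  \<open>lift\<close> and \<open>exchange_lift\<close>.\<close>

lemma real_polynomial_function_if:
  "(c \<Longrightarrow> real_polynomial_function f) \<Longrightarrow> (\<not> c \<Longrightarrow> real_polynomial_function g) \<Longrightarrow>
   real_polynomial_function (\<lambda>x. if c then f x else g x)"
  by (cases c) auto

lemmas real_polynomial_intros =
  real_polynomial_function.intros(2-4) real_polynomial_function_diff real_polynomial_function_if polynomial_matrixD

lemma is_sos_inner_self:
  assumes "polynomial_matrix M"
  shows "is_sos (\<lambda>x. M x \<bullet> M x)"
  unfolding inner_matrix power2_eq_square[symmetric]
  by (intro is_sos_sum is_sos_square polynomial_matrixD assms)

text \<open>For this value the leading coefficient is \<open>(n + 2) / 2\<close>, and each of the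
  three blocks is an explicit sum of squares. The bound on the dimension makes the weight
  \<open>(n - 2) / 2\<close> nonnegative.\<close>

lemma is_sos_BW_form:
  assumes "CARD('n::finite) \<ge> 2"
  shows "is_sos (BW_form ((real CARD('n) - 2) / 2) :: (real ^ 'n ^ 'n) \<times> (real ^ 'n ^ 'n) \<Rightarrow> real)"
proof -
  define n where "n = real CARD('n)"
  have n: "n \<ge> 2" using assms unfolding n_def by simp
  define S T K L :: "(real ^ 'n ^ 'n) \<times> (real ^ 'n ^ 'n) \<Rightarrow> real ^ 'n ^ 'n" where
    "S = (\<lambda>x. (1/2) *\<^sub>R (fst x + transpose (fst x)))" and
    "T = (\<lambda>x. (1/2) *\<^sub>R (snd x + transpose (snd x)))" and
    "K = (\<lambda>x. (1/2) *\<^sub>R (fst x - transpose (fst x)))" and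
    "L = (\<lambda>x. (1/2) *\<^sub>R (snd x - transpose (snd x)))"
  define N where "N = (\<lambda>x. S x ** L x - T x ** K x)"
  define Y where "Y = (\<lambda>x. (1/2) *\<^sub>R (N x + transpose (N x)))"
  define u where "u = (\<lambda>x a b c d. S x $ a $ b * L x $ c $ d - T x $ a $ b * K x $ c $ d)"
  have poly: "polynomial_matrix S" "polynomial_matrix T" "polynomial_matrix K" "polynomial_matrix L"
    unfolding S_def T_def K_def L_def
    by (intro polynomial_matrix_add polynomial_matrix_diff polynomial_matrix_scaleR polynomial_matrix_transpose
      polynomial_matrix_linear bounded_linear_fst bounded_linear_snd)+
  have polyN: "polynomial_matrix N"
    unfolding N_def by (intro polynomial_matrix_diff polynomial_matrix_mult poly)
  have polyY: "polynomial_matrix Y"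
    unfolding Y_def by (intro polynomial_matrix_add polynomial_matrix_scaleR polynomial_matrix_transpose polyN)
  have polyC: "polynomial_matrix (\<lambda>x. commutator (S x) (T x))" "polynomial_matrix (\<lambda>x. commutator (K x) (L x))"
    by (intro polynomial_matrix_diff polynomial_matrix_mult poly)+
  \<comment> \<open>The coefficient \<open>1 / (n + 2)\<close> is that of the projection for
    \<open>s = 1\<close>; with the weight \<open>(n + 2) / 4\<close> exactly one copy of the squared
    commutator is subtracted.\<close>
  define w1 where "w1 x a b c d = S x $ a $ b * T x $ c $ d - T x $ a $ b * S x $ c $ d
      - 1 / (n + 2) * lift 1 1 (commutator (S x) (T x)) a b c d" for x a b c d
  \<comment> \<open>For \<open>s = -1\<close> the projection would need \<open>1 / (n - 2)\<close>,
    which fails for \<open>n = 2\<close>. With \<open>1 / (n + 2)\<close> too much of the squared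
    commutator is subtracted, and the excess \<open>4 / (n + 2)\<close> is restored as a separate
    square.\<close>
  define w2 where "w2 x a b c d = K x $ a $ b * L x $ c $ d - L x $ a $ b * K x $ c $ d
      - 1 / (n + 2) * lift (-1) (-1) (commutator (K x) (L x)) a b c d" for x a b c d
  define w3 where "w3 x a b c d = u x a b c d - 1 / n * lift 1 (-1) (Y x) a b c d" for x a b c d
  define w4 where "w4 x b a e d = u x b a e d - u x b e a d - 1 / n * exchange_lift (Y x) b a e d" for x b a e d
  have polyw: "real_polynomial_function (\<lambda>x. w1 x a b c d)" "real_polynomial_function (\<lambda>x. w2 x a b c d)"
     "real_polynomial_function (\<lambda>x. w3 x a b c d)" "real_polynomial_function (\<lambda>x. w4 x a b c d)" for a b c d
    unfolding w1_def w2_def w3_def w4_def u_def lift_def exchange_lift_def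
    by (intro real_polynomial_intros poly polyC polyY)+
  \<comment> \<open>One group of squares per decoupled component: \<open>w1\<close> for the
    symmetric wedge, \<open>w2\<close> for the skew wedge, and \<open>w3\<close>, \<open>w4\<close>
    and \<open>N - Y\<close> for the mixed tensor \<open>u\<close>.\<close>
  have eq: "BW_form ((real CARD('n) - 2) / 2) = (\<lambda>x::(real ^ 'n ^ 'n) \<times> (real ^ 'n ^ 'n).
     (n + 2) / 4 * (\<Sum>a\<in>UNIV. \<Sum>b\<in>UNIV. \<Sum>c\<in>UNIV. \<Sum>d\<in>UNIV. (w1 x a b c d)\<^sup>2)
   + ((n + 2) / 4 * (\<Sum>a\<in>UNIV. \<Sum>b\<in>UNIV. \<Sum>c\<in>UNIV. \<Sum>d\<in>UNIV. (w2 x a b c d)\<^sup>2)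
      + 4 / (n + 2) * (commutator (K x) (L x) \<bullet> commutator (K x) (L x)))
   + ((n - 2) / 2 * (\<Sum>a\<in>UNIV. \<Sum>b\<in>UNIV. \<Sum>c\<in>UNIV. \<Sum>d\<in>UNIV. (w3 x a b c d)\<^sup>2)
      + (\<Sum>a\<in>UNIV. \<Sum>b\<in>UNIV. \<Sum>c\<in>UNIV. \<Sum>d\<in>UNIV. (w4 x a b c d)\<^sup>2)
      + 2 * ((N x - Y x) \<bullet> (N x - Y x))))" (is "_ = ?R")
  proof
    fix x :: "(real ^ 'n ^ 'n) \<times> (real ^ 'n ^ 'n)"
    have sym: "transpose (S x) = S x" "transpose (T x) = T x"
      and skew: "transpose (K x) = - K x" "transpose (L x) = - L x"
      unfolding S_def T_def K_def L_def
      by (simp_all add: transpose_scaleR transpose_add transpose_diff vec_eq_iff field_simps)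
    have x: "x = (S x + K x, T x + L x)"
      unfolding S_def T_def K_def L_def prod_eq_iff
      by (simp add: vec_eq_iff field_simps)
    have N: "N x = S x ** L x - T x ** K x" and Y: "Y x = (1/2) *\<^sub>R (N x + transpose (N x))"
      and u: "u x = (\<lambda>a b c d. S x $ a $ b * L x $ c $ d - T x $ a $ b * K x $ c $ d)"
      unfolding N_def Y_def u_def by auto
    have 2: "2 + (real CARD('n) - 2) / 2 = (n + 2) / 2"
      unfolding n_def by (simp add: field_simps)
    have quarter: "(n + 2) / 4 * (2 * w - (8 * (1 / (n + 2)) - 4 * (1 / (n + 2))\<^sup>2 * (n + 2 * 1)) * k)
        = (n + 2) / 2 * w - k"
      and quarter': "(n + 2) / 4 * (2 * w - (8 * (1 / (n + 2)) - 4 * (1 / (n + 2))\<^sup>2 * (n + 2 * (-1))) * k)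
        + 4 / (n + 2) * k = (n + 2) / 2 * w - k" for w k
      using n by (simp_all add: divide_simps power2_eq_square) (simp_all add: algebra_simps)
    have "(\<Sum>a\<in>UNIV. \<Sum>b\<in>UNIV. \<Sum>c\<in>UNIV. \<Sum>d\<in>UNIV. (w1 x a b c d)\<^sup>2)
      = 2 * ((S x \<bullet> S x) * (T x \<bullet> T x) - (S x \<bullet> T x)\<^sup>2)
      - (8 * (1 / (n + 2)) - 4 * (1 / (n + 2))\<^sup>2 * (n + 2 * 1)) * (commutator (S x) (T x) \<bullet> commutator (S x) (T x))"
      unfolding w1_def n_def by (rule wedge_commutator_identity) (simp_all add: sym)
    then have 3: "(n + 2) / 4 * (\<Sum>a\<in>UNIV. \<Sum>b\<in>UNIV. \<Sum>c\<in>UNIV. \<Sum>d\<in>UNIV. (w1 x a b c d)\<^sup>2)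
      = (n + 2) / 2 * ((S x \<bullet> S x) * (T x \<bullet> T x) - (S x \<bullet> T x)\<^sup>2) - commutator (S x) (T x) \<bullet> commutator (S x) (T x)"
      by (simp only: quarter)
    have "(\<Sum>a\<in>UNIV. \<Sum>b\<in>UNIV. \<Sum>c\<in>UNIV. \<Sum>d\<in>UNIV. (w2 x a b c d)\<^sup>2)
      = 2 * ((K x \<bullet> K x) * (L x \<bullet> L x) - (K x \<bullet> L x)\<^sup>2)
      - (8 * (1 / (n + 2)) - 4 * (1 / (n + 2))\<^sup>2 * (n + 2 * (-1))) * (commutator (K x) (L x) \<bullet> commutator (K x) (L x))"
      unfolding w2_def n_def by (rule wedge_commutator_identity) (simp_all add: skew)
    then have 4: "(n + 2) / 4 * (\<Sum>a\<in>UNIV. \<Sum>b\<in>UNIV. \<Sum>c\<in>UNIV. \<Sum>d\<in>UNIV. (w2 x a b c d)\<^sup>2)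
       + 4 / (n + 2) * (commutator (K x) (L x) \<bullet> commutator (K x) (L x))
      = (n + 2) / 2 * ((K x \<bullet> K x) * (L x \<bullet> L x) - (K x \<bullet> L x)\<^sup>2) - commutator (K x) (L x) \<bullet> commutator (K x) (L x)"
      by (simp only: quarter')
    show "BW_form ((real CARD('n) - 2) / 2) x = ?R x"
      apply (subst x)
      unfolding BW_form_decomposition[OF sym skew N Y] 2 3 4 w3_def w4_def mixed_identity[OF sym skew N Y u n_def] ..
  qed
  show ?thesis
    unfolding eq
    by (intro is_sos_add is_sos_cmult is_sos_sum is_sos_square is_sos_inner_self polyw polyC
        polynomial_matrix_diff polyN polyY) (use n in auto)
qed

subsection \<open>Quadratic parts of the summands\<close>

text \<open>Structural induction on the polynomial. Only limits along rays are taken later, so it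
  suffices that the remainder is continuous in \<open>t\<close> for each fixed \<open>x\<close>. The
  form \<open>\<beta>\<close> need not be symmetric: a product contributes
  \<open>l x * l' y\<close>.\<close>

lemma real_polynomial_function_taylor2:
  fixes q :: "'a::real_normed_vector \<Rightarrow> real"
  assumes "real_polynomial_function q"
  shows "\<exists>c l \<beta> r. linear l \<and> bilinear \<beta> \<and> (\<forall>x. continuous_on UNIV (r x)) \<and>
    (\<forall>x t. q (t *\<^sub>R x) = c + t * l x + t\<^sup>2 * \<beta> x x + t ^ 3 * r x t)"
  using assms
proof induction
  case (linear f)
  then have "linear f" by (rule bounded_linear.linear)
  then show ?case
    by (intro exI[of _ 0] exI[of _ f] exI[of _ "\<lambda>x y. 0"] exI[of _ "\<lambda>x t. 0"])
       (simp add: bilinear_def linear_scale linear_zero)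
next
  case (const c)
  show ?case
    by (intro exI[of _ c] exI[of _ "\<lambda>x. 0"] exI[of _ "\<lambda>x y. 0"] exI[of _ "\<lambda>x t. 0"])
       (simp add: bilinear_def linear_zero)
next
  case (add f g)
  then obtain c l \<beta> r c' l' \<beta>' r' where
    f: "linear l" "bilinear \<beta>" "\<And>x. continuous_on UNIV (r x)"
      "\<And>x t. f (t *\<^sub>R x) = c + t * l x + t\<^sup>2 * \<beta> x x + t ^ 3 * r x t" and
    g: "linear l'" "bilinear \<beta>'" "\<And>x. continuous_on UNIV (r' x)"
      "\<And>x t. g (t *\<^sub>R x) = c' + t * l' x + t\<^sup>2 * \<beta>' x x + t ^ 3 * r' x t"
    by metis
  show ?case
  proof (intro exI conjI allI)
    show "linear (\<lambda>x. l x + l' x)" using f g by (intro linear_compose_add)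
    show "bilinear (\<lambda>x y. \<beta> x y + \<beta>' x y)"
      using f(2) g(2) unfolding bilinear_def by (auto intro: linear_compose_add)
    show "continuous_on UNIV (\<lambda>t. r x t + r' x t)" for x
      using f g by (intro continuous_intros) auto
    show "f (t *\<^sub>R x) + g (t *\<^sub>R x) = (c + c') + t * (l x + l' x) + t\<^sup>2 * (\<beta> x x + \<beta>' x x)
        + t ^ 3 * (r x t + r' x t)" for x t
      unfolding f g by (simp add: algebra_simps)
  qed
next
  case (mult f g)
  then obtain c l \<beta> r c' l' \<beta>' r' where
    f: "linear l" "bilinear \<beta>" "\<And>x. continuous_on UNIV (r x)"
      "\<And>x t. f (t *\<^sub>R x) = c + t * l x + t\<^sup>2 * \<beta> x x + t ^ 3 * r x t" and
    g: "linear l'" "bilinear \<beta>'" "\<And>x. continuous_on UNIV (r' x)"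
      "\<And>x t. g (t *\<^sub>R x) = c' + t * l' x + t\<^sup>2 * \<beta>' x x + t ^ 3 * r' x t"
    by metis
  have smult: "linear (\<lambda>x. k * h x)" "linear (\<lambda>x. h x * k)" if "linear h" for k and h :: "'a \<Rightarrow> real"
    using that by (auto simp: linear_iff algebra_simps)
  show ?case
  proof (intro exI conjI allI)
    show "linear (\<lambda>x. c * l' x + c' * l x)" using f g by (intro linear_compose_add smult)
    show "bilinear (\<lambda>x y. c * \<beta>' x y + c' * \<beta> x y + l x * l' y)"
      using f(1,2) g(1,2) unfolding bilinear_def by (auto intro!: linear_compose_add smult)
    show "continuous_on UNIV (\<lambda>t. (c + t * l x + t\<^sup>2 * \<beta> x x + t ^ 3 * r x t) * r' x t
       + r x t * (c' + t * l' x + t\<^sup>2 * \<beta>' x x) + l x * \<beta>' x x + \<beta> x x * l' x + t * \<beta> x x * \<beta>' x x)" for x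
      using f(3) g(3) by (intro continuous_intros) auto
    show "f (t *\<^sub>R x) * g (t *\<^sub>R x) = c * c' + t * (c * l' x + c' * l x)
        + t\<^sup>2 * (c * \<beta>' x x + c' * \<beta> x x + l x * l' x)
        + t ^ 3 * ((c + t * l x + t\<^sup>2 * \<beta> x x + t ^ 3 * r x t) * r' x t
       + r x t * (c' + t * l' x + t\<^sup>2 * \<beta>' x x) + l x * \<beta>' x x + \<beta> x x * l' x + t * \<beta> x x * \<beta>' x x)" for x t
      unfolding f g by (simp add: algebra_simps power2_eq_square power3_eq_cube)
  qed
qed

text \<open>Allows an identity obtained by dividing by a power of \<open>t\<close> to be evaluated
  at \<open>t = 0\<close>.\<close>

lemma continuous_eq_at_0:
  fixes f g :: "real \<Rightarrow> real"
  assumes "continuous_on UNIV f" "continuous_on UNIV g" "\<And>t. t \<noteq> 0 \<Longrightarrow> f t = g t"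
  shows "f 0 = g 0"
proof -
  have "(f \<longlongrightarrow> f 0) (at 0)" "(g \<longlongrightarrow> g 0) (at 0)"
    using assms(1,2) by (simp_all add: continuous_on_eq_continuous_at isCont_def)
  moreover have "(g \<longlongrightarrow> f 0) (at 0)"
    using \<open>(f \<longlongrightarrow> f 0) (at 0)\<close>
    by (rule Lim_transform_eventually) (auto simp: eventually_at_filter assms(3))
  ultimately show ?thesis
    using LIM_unique by blast
qed

lemma continuous_on_sum_list:
  fixes f :: "'b \<Rightarrow> real \<Rightarrow> real"
  assumes "\<And>q. q \<in> set qs \<Longrightarrow> continuous_on UNIV (f q)"
  shows "continuous_on UNIV (\<lambda>t. \<Sum>q\<leftarrow>qs. f q t)"
  using assms by (induction qs) (auto intro!: continuous_intros)

lemma sum_list_squares_eq_0: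
  fixes f :: "'b \<Rightarrow> real"
  assumes "(\<Sum>q\<leftarrow>qs. (f q)\<^sup>2) = 0" "q \<in> set qs"
  shows "f q = 0"
proof -
  have "\<forall>y\<in>set (map (\<lambda>q. (f q)\<^sup>2) qs). y = 0"
    using assms(1) by (subst sum_list_nonneg_eq_0_iff[symmetric]) auto
  then show ?thesis using assms(2) by auto
qed

text \<open>Orders in \<open>t\<close> are compared along each ray. A sum of real squares vanishes
  only termwise, which removes first the constant and then the linear parts; at order four only the
  quadratic parts remain.\<close>

lemma sos_quartic_form:
  fixes F :: "'a::euclidean_space \<Rightarrow> real"
  assumes "is_sos F" and hom: "\<And>t x. F (t *\<^sub>R x) = t ^ 4 * F x"
  obtains \<beta>s :: "('a \<Rightarrow> 'a \<Rightarrow> real) list"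
  where "\<And>\<beta>. \<beta> \<in> set \<beta>s \<Longrightarrow> bilinear \<beta>" "\<And>x. F x = (\<Sum>\<beta>\<leftarrow>\<beta>s. (\<beta> x x)\<^sup>2)"
proof -
  obtain qs where qs: "\<And>q. q \<in> set qs \<Longrightarrow> real_polynomial_function q" and F: "F = (\<lambda>x. \<Sum>q\<leftarrow>qs. (q x)\<^sup>2)"
    using assms(1) unfolding is_sos_def by metis
  obtain c l \<beta> r where *: "\<And>q. q \<in> set qs \<Longrightarrow> linear (l q) \<and> bilinear (\<beta> q) \<and> (\<forall>x. continuous_on UNIV (r q x)) \<and>
    (\<forall>x t. q (t *\<^sub>R x) = c q + t * l q x + t\<^sup>2 * \<beta> q x x + t ^ 3 * r q x t)"
    using real_polynomial_function_taylor2[OF qs] by metis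
  then have q: "q (t *\<^sub>R x) = c q + t * l q x + t\<^sup>2 * \<beta> q x x + t ^ 3 * r q x t" if "q \<in> set qs" for q x t
    using that by blast
  have cont: "continuous_on UNIV (r q x)" if "q \<in> set qs" for q x
    using * that by blast
  have c0: "c q = 0" if "q \<in> set qs" for q
  proof -
    have "(\<Sum>q\<leftarrow>qs. (q 0)\<^sup>2) = 0"
      using hom[of 0 0] unfolding F by simp
    then have "q 0 = 0" using sum_list_squares_eq_0[of "\<lambda>q. q 0"] that by blast
    then show ?thesis using q[OF that, of 0 0] by simp
  qed
  \<comment> \<open>Without constant terms every summand is divisible by \<open>t\<close> along the
    ray, so \<open>t\<^sup>2\<close> cancels; at \<open>t = 0\<close> this forces the linear parts
    to vanish, and the same division is then repeated.\<close>
  have 1: "(\<Sum>q\<leftarrow>qs. (l q x + t * \<beta> q x x + t\<^sup>2 * r q x t)\<^sup>2) = t\<^sup>2 * F x" if "t \<noteq> 0" for x t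
  proof -
    have "t ^ 4 * F x = (\<Sum>q\<leftarrow>qs. (q (t *\<^sub>R x))\<^sup>2)"
      using hom[of t x] unfolding F by simp
    also have "\<dots> = (\<Sum>q\<leftarrow>qs. t\<^sup>2 * (l q x + t * \<beta> q x x + t\<^sup>2 * r q x t)\<^sup>2)"
      by (rule arg_cong[of _ _ sum_list], rule map_cong[OF refl])
         (simp add: q c0 algebra_simps power2_eq_square power3_eq_cube)
    also have "\<dots> = t\<^sup>2 * (\<Sum>q\<leftarrow>qs. (l q x + t * \<beta> q x x + t\<^sup>2 * r q x t)\<^sup>2)"
      by (rule sum_list_const_mult)
    finally show ?thesis
      using that by (simp add: power2_eq_square eval_nat_numeral)
  qed
  have l0: "l q x = 0" if "q \<in> set qs" for q x
  proof -
    have "(\<Sum>q\<leftarrow>qs. (l q x + 0 * \<beta> q x x + 0\<^sup>2 * r q x 0)\<^sup>2) = 0\<^sup>2 * F x"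
      by (rule continuous_eq_at_0[of "\<lambda>t. \<Sum>q\<leftarrow>qs. (l q x + t * \<beta> q x x + t\<^sup>2 * r q x t)\<^sup>2" "\<lambda>t. t\<^sup>2 * F x"])
         (use 1 in \<open>auto intro!: continuous_intros continuous_on_sum_list cont\<close>)
    then show ?thesis
      using sum_list_squares_eq_0[of "\<lambda>q. l q x" qs q] that by simp
  qed
  have 2: "(\<Sum>q\<leftarrow>qs. (\<beta> q x x + t * r q x t)\<^sup>2) = F x" if "t \<noteq> 0" for x t
  proof -
    have "t\<^sup>2 * F x = (\<Sum>q\<leftarrow>qs. (l q x + t * \<beta> q x x + t\<^sup>2 * r q x t)\<^sup>2)"
      using 1[OF that] by simp
    also have "\<dots> = (\<Sum>q\<leftarrow>qs. t\<^sup>2 * (\<beta> q x x + t * r q x t)\<^sup>2)"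
      by (rule arg_cong[of _ _ sum_list], rule map_cong[OF refl])
         (simp add: l0 algebra_simps power2_eq_square)
    also have "\<dots> = t\<^sup>2 * (\<Sum>q\<leftarrow>qs. (\<beta> q x x + t * r q x t)\<^sup>2)"
      by (rule sum_list_const_mult)
    finally show ?thesis using that by simp
  qed
  have "F x = (\<Sum>q\<leftarrow>qs. (\<beta> q x x)\<^sup>2)" for x
  proof -
    have "(\<Sum>q\<leftarrow>qs. (\<beta> q x x + 0 * r q x 0)\<^sup>2) = F x"
      by (rule continuous_eq_at_0[of "\<lambda>t. \<Sum>q\<leftarrow>qs. (\<beta> q x x + t * r q x t)\<^sup>2" "\<lambda>t. F x"])
         (use 2 in \<open>auto intro!: continuous_intros continuous_on_sum_list cont\<close>)
    then show ?thesis by simp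
  qed
  then show ?thesis
    using * by (intro that[of "map \<beta> qs"]) (auto simp: o_def)
qed

text \<open>Every summand vanishes wherever \<open>F\<close> does. The zeros \<open>(x, 0)\<close>
  and \<open>(0, y)\<close> remove the pure parts of each quadratic form and leave its mixed part;
  the zeros \<open>(x, x)\<close> make that part alternating.\<close>

lemma sos_biquadratic_alternating:
  fixes F :: "'a::euclidean_space \<times> 'a \<Rightarrow> real"
  assumes "is_sos F" and hom: "\<And>t x. F (t *\<^sub>R x) = t ^ 4 * F x"
    and 0: "\<And>x. F (x, 0) = 0" "\<And>y. F (0, y) = 0" "\<And>x. F (x, x) = 0"
  obtains bs :: "('a \<Rightarrow> 'a \<Rightarrow> real) list"
  where "\<And>b. b \<in> set bs \<Longrightarrow> bilinear b" "\<And>b x. b \<in> set bs \<Longrightarrow> b x x = 0"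
    "\<And>x y. F (x, y) = (\<Sum>b\<leftarrow>bs. (b x y)\<^sup>2)"
proof -
  obtain \<beta>s :: "('a \<times> 'a \<Rightarrow> 'a \<times> 'a \<Rightarrow> real) list" where
    bil: "\<And>\<beta>. \<beta> \<in> set \<beta>s \<Longrightarrow> bilinear \<beta>" and F: "\<And>x. F x = (\<Sum>\<beta>\<leftarrow>\<beta>s. (\<beta> x x)\<^sup>2)"
    using sos_quartic_form[OF assms(1,2)] by blast
  have zero: "\<beta> z z = 0" if "\<beta> \<in> set \<beta>s" "F z = 0" for \<beta> z
    using sum_list_squares_eq_0[of "\<lambda>\<beta>. \<beta> z z" \<beta>s \<beta>] that F by simp
  define b where "b = (\<lambda>\<beta> :: 'a \<times> 'a \<Rightarrow> 'a \<times> 'a \<Rightarrow> real. \<lambda>x y. \<beta> (x, 0) (0, y) + \<beta> (0, y) (x, 0))"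
  have b: "b \<beta> x y = \<beta> (x, y) (x, y)" if "\<beta> \<in> set \<beta>s" for \<beta> x y
  proof -
    have "\<beta> (x, y) (x, y) = \<beta> ((x, 0) + (0, y)) ((x, 0) + (0, y))" by simp
    also have "\<dots> = \<beta> (x, 0) (x, 0) + \<beta> (x, 0) (0, y) + \<beta> (0, y) (x, 0) + \<beta> (0, y) (0, y)"
      using bil[OF that] by (simp only: bilinear_ladd bilinear_radd)
    finally show ?thesis
      using zero[OF that 0(1)] zero[OF that 0(2)] unfolding b_def by simp
  qed
  have lin: "linear (\<lambda>x::'a. (x, 0::'a))" "linear (\<lambda>y::'a. (0::'a, y))"
    by (auto simp: linear_iff)
  have bilb: "bilinear (b \<beta>)" if "\<beta> \<in> set \<beta>s" for \<beta>
  proof -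
    have "linear (\<beta> z)" "linear (\<lambda>z. \<beta> z w)" for z w
      using bil[OF that] unfolding bilinear_def by blast+
    from this(1)[THEN linear_compose[OF lin(1)]] this(1)[THEN linear_compose[OF lin(2)]]
      this(2)[THEN linear_compose[OF lin(1)]] this(2)[THEN linear_compose[OF lin(2)]]
    show ?thesis
      unfolding b_def bilinear_def o_def by (intro conjI allI linear_compose_add)
  qed
  show ?thesis
  proof (rule that[of "map b \<beta>s"])
    show "bilinear c" if "c \<in> set (map b \<beta>s)" for c
      using that bilb by auto
    show "c x x = 0" if "c \<in> set (map b \<beta>s)" for c x
      using that b zero 0(3) by auto
    show "F (x, y) = (\<Sum>b\<leftarrow>map b \<beta>s. (b x y)\<^sup>2)" for x y
      unfolding F map_map o_def
      by (rule arg_cong[of _ _ sum_list], rule map_cong[OF refl]) (simp add: b)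
  qed
qed

subsection \<open>Polarization along 4-cycles\<close>

text \<open>A second difference in both arguments at once, pairing \<open>x\<close> with
  \<open>z\<close> and \<open>y\<close> with \<open>w\<close>. It is linear in \<open>F\<close>, so
  it passes from a sum of squares to its summands.\<close>

definition polarize :: "('a::real_vector \<times> 'a \<Rightarrow> real) \<Rightarrow> 'a \<Rightarrow> 'a \<Rightarrow> 'a \<Rightarrow> 'a \<Rightarrow> real" where
  "polarize F x z y w = F (x + z, y + w) - F (x + z, y - w) - F (x - z, y + w) + F (x - z, y - w)"

lemma polarize_linear:
  "polarize (\<lambda>p. k * (A p - B p) - C p) x z y w
    = k * (polarize A x z y w - polarize B x z y w) - polarize C x z y w"
  by (simp add: polarize_def algebra_simps)

text \<open>Vector values let one formula serve the inner product, the commutator and the summands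
  of a sum of squares.\<close>

lemma polarize_norm_bilinear:
  fixes b :: "'a::real_vector \<Rightarrow> 'a \<Rightarrow> 'b::real_inner"
  assumes "bilinear b"
  shows "polarize (\<lambda>(x, y). b x y \<bullet> b x y) x z y w = 8 * (b x y \<bullet> b z w + b x w \<bullet> b z y)"
  unfolding polarize_def prod.case bilinear_ladd[OF assms] bilinear_radd[OF assms]
    bilinear_lsub[OF assms] bilinear_rsub[OF assms]
  by (simp add: inner_add_left inner_add_right inner_diff_left inner_diff_right inner_commute)

text \<open>The form is a product of one factor per argument, so the second difference splits into
  two differences, each giving a factor 4.\<close>

lemma polarize_norm_mult:
  fixes x y z w :: "'a::real_inner"
  shows "polarize (\<lambda>(x, y). (x \<bullet> x) * (y \<bullet> y)) x z y w = 16 * (x \<bullet> z) * (y \<bullet> w)"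
proof -
  have "(x + z) \<bullet> (x + z) = x \<bullet> x + 2 * (x \<bullet> z) + z \<bullet> z" "(x - z) \<bullet> (x - z) = x \<bullet> x - 2 * (x \<bullet> z) + z \<bullet> z"
    for x z :: 'a
    by (simp_all add: inner_add_left inner_add_right inner_diff_left inner_diff_right inner_commute)
  moreover have "(a + 2 * b + c) * (d + 2 * e + f) - (a + 2 * b + c) * (d - 2 * e + f)
      - (a - 2 * b + c) * (d + 2 * e + f) + (a - 2 * b + c) * (d - 2 * e + f) = 16 * b * e"
    for a b c d e f :: real
    by (simp add: algebra_simps)
  ultimately show ?thesis
    unfolding polarize_def prod.case by presburger
qed

lemma bilinear_inner: "bilinear ((\<bullet>) :: 'a::real_inner \<Rightarrow> 'a \<Rightarrow> real)"
  by (simp add: bilinear_def linear_iff inner_add_left inner_add_right)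

lemma bilinear_commutator: "bilinear (commutator :: real ^ 'n ^ 'n \<Rightarrow> _)"
  by (simp add: bilinear_def linear_iff matrix_add_ldistrib matrix_add_rdistrib
      scalar_matrix_assoc[symmetric] matrix_scalar_ac scaleR_diff_right)

text \<open>The relabelling rotates the cycle \<open>i, k, j, l\<close> by one step.\<close>

lemma sum_rotate4:
  fixes G :: "'n::finite \<Rightarrow> 'n \<Rightarrow> 'n \<Rightarrow> 'n \<Rightarrow> real"
  shows "(\<Sum>i\<in>UNIV. \<Sum>j\<in>UNIV. \<Sum>k\<in>UNIV. \<Sum>l\<in>UNIV. G l i k j) = (\<Sum>i\<in>UNIV. \<Sum>j\<in>UNIV. \<Sum>k\<in>UNIV. \<Sum>l\<in>UNIV. G i k j l)"
proof -
  have "(\<Sum>i\<in>UNIV. \<Sum>j\<in>UNIV. \<Sum>k\<in>UNIV. \<Sum>l\<in>UNIV. G l i k j) = (\<Sum>i\<in>UNIV. \<Sum>j\<in>UNIV. \<Sum>l\<in>UNIV. \<Sum>k\<in>UNIV. G l i k j)"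
    by (intro sum.cong refl sum.swap)
  also have "\<dots> = (\<Sum>i\<in>UNIV. \<Sum>l\<in>UNIV. \<Sum>j\<in>UNIV. \<Sum>k\<in>UNIV. G l i k j)"
    by (intro sum.cong refl sum.swap)
  also have "\<dots> = (\<Sum>l\<in>UNIV. \<Sum>i\<in>UNIV. \<Sum>j\<in>UNIV. \<Sum>k\<in>UNIV. G l i k j)"
    by (rule sum.swap)
  also have "\<dots> = (\<Sum>l\<in>UNIV. \<Sum>i\<in>UNIV. \<Sum>k\<in>UNIV. \<Sum>j\<in>UNIV. G l i k j)"
    by (intro sum.cong refl sum.swap)
  also have "\<dots> = (\<Sum>l\<in>UNIV. \<Sum>k\<in>UNIV. \<Sum>i\<in>UNIV. \<Sum>j\<in>UNIV. G l i k j)"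
    by (intro sum.cong refl sum.swap)
  finally show ?thesis .
qed

text \<open>Two sign changes turn the second term into a rotation of the first, so both have the
  same sum. Reversing the path from \<open>j\<close> through \<open>l\<close> to \<open>i\<close>
  costs one sign and turns that sum into minus a sum of squared norms.\<close>

lemma sum_polarized_cycle:
  fixes b :: "'a::real_vector \<Rightarrow> 'a \<Rightarrow> 'b::real_inner" and e :: "'n::finite \<Rightarrow> 'n \<Rightarrow> 'a"
  assumes "bilinear b" and alt: "\<And>x. b x x = 0" and e: "\<And>i j. e i j = e j i"
  shows "(\<Sum>i\<in>UNIV. \<Sum>j\<in>UNIV. \<Sum>k\<in>UNIV. \<Sum>l\<in>UNIV. b (e i k) (e k j) \<bullet> b (e j l) (e l i) + b (e i k) (e l i) \<bullet> b (e j l) (e k j))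
    = - 2 * (\<Sum>i\<in>UNIV. \<Sum>j\<in>UNIV. (\<Sum>k\<in>UNIV. b (e i k) (e k j)) \<bullet> (\<Sum>k\<in>UNIV. b (e i k) (e k j)))"
proof -
  define G where "G = (\<lambda>i k j l. b (e i k) (e k j) \<bullet> b (e j l) (e l i))"
  have anti: "b x y = - b y x" for x y
    using alt[of "x + y"] alt[of x] alt[of y]
    by (simp add: bilinear_ladd[OF assms(1)] bilinear_radd[OF assms(1)] eq_neg_iff_add_eq_0 add.commute)
  have "b (e i k) (e l i) \<bullet> b (e j l) (e k j) = G l i k j" for i j k l
    unfolding G_def by (subst anti[of "e i k"], subst anti[of "e j l"]) simp
  then have "(\<Sum>i\<in>UNIV. \<Sum>j\<in>UNIV. \<Sum>k\<in>UNIV. \<Sum>l\<in>UNIV. b (e i k) (e k j) \<bullet> b (e j l) (e l i) + b (e i k) (e l i) \<bullet> b (e j l) (e k j))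
    = (\<Sum>i\<in>UNIV. \<Sum>j\<in>UNIV. \<Sum>k\<in>UNIV. \<Sum>l\<in>UNIV. G i k j l) + (\<Sum>i\<in>UNIV. \<Sum>j\<in>UNIV. \<Sum>k\<in>UNIV. \<Sum>l\<in>UNIV. G l i k j)"
    by (simp add: sum.distrib) (simp add: G_def)
  moreover have "(\<Sum>i\<in>UNIV. \<Sum>j\<in>UNIV. \<Sum>k\<in>UNIV. \<Sum>l\<in>UNIV. G i k j l)
    = (\<Sum>i\<in>UNIV. \<Sum>j\<in>UNIV. - ((\<Sum>k\<in>UNIV. b (e i k) (e k j)) \<bullet> (\<Sum>k\<in>UNIV. b (e i k) (e k j))))"
  proof (intro sum.cong refl)
    fix i j
    have "G i k j l = - (b (e i k) (e k j) \<bullet> b (e i l) (e l j))" for k l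
      unfolding G_def by (subst anti[of "e j l"]) (simp add: e[of l i] e[of j l])
    then show "(\<Sum>k\<in>UNIV. \<Sum>l\<in>UNIV. G i k j l) = - ((\<Sum>k\<in>UNIV. b (e i k) (e k j)) \<bullet> (\<Sum>k\<in>UNIV. b (e i k) (e k j)))"
      by (simp add: inner_sum_left inner_sum_right sum_negf) (rule sum.swap)
  qed
  ultimately show ?thesis
    unfolding sum_rotate4[of G] by (simp only: sum_negf)
qed

section \<open>The test matrices and their cycle sums\<close>

definition matrix_unit :: "'n \<Rightarrow> 'n \<Rightarrow> real ^ 'n ^ 'n" where
  "matrix_unit i j = axis i (axis j 1)"

text \<open>On the diagonal this is twice a matrix unit; without renormalization the product
  formulas stay uniform in the indices.\<close>

definition sym_unit :: "'n \<Rightarrow> 'n \<Rightarrow> real ^ 'n ^ 'n" where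
  "sym_unit i j = matrix_unit i j + matrix_unit j i"

lemma sym_unit_commute: "sym_unit i j = sym_unit j i"
  unfolding sym_unit_def by (rule add.commute)

lemma inner_matrix_unit: "matrix_unit i j \<bullet> matrix_unit k l = (if i = k \<and> j = l then 1 else 0)"
  unfolding matrix_unit_def inner_axis_axis by simp

lemma inner_sym_unit:
  "sym_unit i j \<bullet> sym_unit k l = 2 * ((if i = k \<and> j = l then 1 else 0) + (if i = l \<and> j = k then 1 else 0))"
proof -
  have *: "matrix_unit j i \<bullet> matrix_unit k l = matrix_unit i j \<bullet> matrix_unit l k"
    "matrix_unit j i \<bullet> matrix_unit l k = matrix_unit i j \<bullet> matrix_unit k l"
    unfolding inner_matrix_unit by (simp_all only: conj_commute)
  have "sym_unit i j \<bullet> sym_unit k l = 2 * (matrix_unit i j \<bullet> matrix_unit k l + matrix_unit i j \<bullet> matrix_unit l k)"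
    unfolding sym_unit_def inner_add_left inner_add_right * mult_2 by (simp only: add_ac)
  then show ?thesis
    unfolding inner_matrix_unit .
qed

lemma matrix_unit_mult: "matrix_unit i j ** matrix_unit k l = (if j = k then matrix_unit i l else 0)"
proof -
  have "(\<Sum>c\<in>UNIV. axis i (axis j 1) $ a $ c * axis k (axis l 1) $ c $ b)
    = ((if j = k then axis i (axis l 1) else 0) :: real ^ 'a ^ 'a) $ a $ b" for a b
    by (simp add: axis_def if_distrib[of "\<lambda>f. f $ _"] mult_delta_left mult_delta_right cong: if_cong)
  then show ?thesis
    by (simp add: vec_eq_iff matrix_matrix_mult_def matrix_unit_def)
qed

text \<open>The factor \<open>n + 2\<close> collects one \<open>matrix_unit i j\<close> for every
  \<open>k\<close>, and one more each from \<open>k = j\<close> and \<open>k = i\<close>.\<close>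

lemma sum_sym_unit_mult:
  fixes i j :: "'n::finite"
  shows "(\<Sum>k\<in>UNIV. sym_unit i k ** sym_unit k j)
    = (real CARD('n) + 2) *\<^sub>R matrix_unit i j + (if i = j then \<Sum>k\<in>UNIV. matrix_unit k k else 0)"
proof -
  have "(\<Sum>k\<in>UNIV. sym_unit i k ** sym_unit k j)
    = (\<Sum>k\<in>UNIV. matrix_unit i j + (if k = j then matrix_unit i k else 0)
        + ((if i = k then matrix_unit k j else 0) + (if i = j then matrix_unit k k else 0)))"
    by (simp add: sym_unit_def matrix_add_ldistrib matrix_add_rdistrib matrix_unit_mult add_ac)
  then show ?thesis
    by (simp add: sum.distrib sum_if_const sum_constant_scaleR scaleR_add_left scaleR_2 add_ac del: sum_constant)
qed

text \<open>The reversed product is the product formula with \<open>i\<close> and \<open>j\<close>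
  exchanged; its identity-matrix term is symmetric and cancels.\<close>

lemma sum_commutator_sym_unit:
  fixes i j :: "'n::finite"
  shows "(\<Sum>k\<in>UNIV. commutator (sym_unit i k) (sym_unit k j))
    = (real CARD('n) + 2) *\<^sub>R (matrix_unit i j - matrix_unit j i)"
proof -
  have "(\<Sum>k\<in>UNIV. sym_unit k j ** sym_unit i k) = (\<Sum>k\<in>UNIV. sym_unit j k ** sym_unit k i)"
    by (intro sum.cong refl) (metis sym_unit_commute)
  then show ?thesis
    unfolding sum_subtractf by (simp add: sum_sym_unit_mult scaleR_diff_right)
qed

lemma sum_norm_commutator_sym_unit:
  "(\<Sum>i\<in>UNIV. \<Sum>j\<in>UNIV. (\<Sum>k\<in>UNIV. commutator (sym_unit i k) (sym_unit k j)) \<bullet>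
      (\<Sum>k\<in>UNIV. commutator (sym_unit i k) (sym_unit k (j::'n::finite))))
    = 2 * (real CARD('n) + 2)\<^sup>2 * real CARD('n) * (real CARD('n) - 1)"
proof -
  have *: "(\<Sum>k\<in>UNIV. commutator (sym_unit i k) (sym_unit k j)) \<bullet> (\<Sum>k\<in>UNIV. commutator (sym_unit i k) (sym_unit k j))
     = (real CARD('n) + 2)\<^sup>2 * (2 - (if i = j then 2 else 0))" for i j :: 'n
    unfolding sum_commutator_sym_unit
    by (simp add: inner_diff_left inner_diff_right inner_matrix_unit power2_eq_square)
  show ?thesis
    unfolding * unfolding sum_distrib_left[symmetric] sum_subtractf by (simp add: algebra_simps)
qed

text \<open>Each product depends only on which indices coincide, so it is a combination of Kronecker
  deltas, nested so that the sums collapse from the inside.\<close>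

lemma sum_inner_sym_unit_cycle:
  "(\<Sum>i\<in>UNIV. \<Sum>j\<in>UNIV. \<Sum>k\<in>UNIV. \<Sum>l\<in>UNIV.
      2 * (sym_unit i k \<bullet> sym_unit j l) * (sym_unit k j \<bullet> sym_unit l (i::'n::finite))
      - ((sym_unit i k \<bullet> sym_unit k j) * (sym_unit j l \<bullet> sym_unit l i)
         + (sym_unit i k \<bullet> sym_unit l i) * (sym_unit j l \<bullet> sym_unit k j)))
    = - 8 * real CARD('n) * (real CARD('n) - 1) * (real CARD('n) + 2)"
proof -
  \<comment> \<open>If all four indices coincide the product is \<open>4 * 4 = 16\<close>, hence 12
    on top of the generic 4.\<close>
  have 1: "(sym_unit i k \<bullet> sym_unit j l) * (sym_unit k j \<bullet> sym_unit l i)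
      = 4 * (if k = l then if i = j then 1 else 0 else 0)
        + 12 * (if i = l then if i = k then if i = j then 1 else 0 else 0 else 0)" for i j k l :: 'n
    unfolding inner_sym_unit
    by (cases "i = j"; cases "i = k"; cases "i = l"; cases "j = k"; cases "j = l"; cases "k = l"; simp)
  have 2: "(sym_unit i k \<bullet> sym_unit k j) * (sym_unit j l \<bullet> sym_unit l i)
      = 4 * (if i = l then if i = k then if i = j then 1 else 0 else 0 else 0)
        + 4 * (if i = k then if i = j then 1 else 0 else 0)
        + 4 * (if j = l then if i = j then 1 else 0 else 0)
        + 4 * (if i = j then 1 else 0)" for i j k l :: 'n
    unfolding inner_sym_unit
    by (cases "i = j"; cases "i = k"; cases "i = l"; cases "j = k"; cases "j = l"; cases "k = l"; simp)
  have 3: "(sym_unit i k \<bullet> sym_unit l i) * (sym_unit j l \<bullet> sym_unit k j)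
      = 4 * (if i = l then if i = k then if i = j then 1 else 0 else 0 else 0)
        + 4 * (if i = l then if i = k then 1 else 0 else 0)
        + 4 * (if k = l then if j = k then 1 else 0 else 0)
        + 4 * (if k = l then 1 else 0)" for i j k l :: 'n
    unfolding inner_sym_unit
    by (cases "i = j"; cases "i = k"; cases "i = l"; cases "j = k"; cases "j = l"; cases "k = l"; simp)
  show ?thesis
    unfolding 2 3 mult.assoc 1
    by (simp only: sum.distrib sum_subtractf sum_distrib_left[symmetric])
      (simp add: sum_if_const mult_delta_right, simp add: algebra_simps)
qed

section \<open>The lower bound for \<gamma>\<close>

lemma BW_form_eq: "BW_form g (P, Q) = (2 + g) * ((P \<bullet> P) * (Q \<bullet> Q) - (P \<bullet> Q)\<^sup>2) - commutator P Q \<bullet> commutator P Q"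
  unfolding BW_form_def prod.case power2_norm_eq_inner trace_transpose_mult ..

lemma polarize_BW_form:
  "polarize (BW_form g) x z y w = 8 * ((2 + g) * (2 * (x \<bullet> z) * (y \<bullet> w) - ((x \<bullet> y) * (z \<bullet> w) + (x \<bullet> w) * (z \<bullet> y))))
    - 8 * (commutator x y \<bullet> commutator z w + commutator x w \<bullet> commutator z y)"
proof -
  \<comment> \<open>The square of \<open>x \<bullet> y\<close> is written as an inner product of
    reals so that \<open>polarize_norm_bilinear\<close> applies to it.\<close>
  have eq: "BW_form g = (\<lambda>p. (2 + g) * ((\<lambda>(x, y). (x \<bullet> x) * (y \<bullet> y)) p - (\<lambda>(x, y). (x \<bullet> y) \<bullet> (x \<bullet> y)) p)
      - (\<lambda>(x, y). commutator x y \<bullet> commutator x y) p)"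
    by (auto simp: BW_form_eq power2_eq_square)
  have "polarize (BW_form g) x z y w = (2 + g) * (polarize (\<lambda>(x, y). (x \<bullet> x) * (y \<bullet> y)) x z y w
      - polarize (\<lambda>(x, y). (x \<bullet> y) \<bullet> (x \<bullet> y)) x z y w)
      - polarize (\<lambda>(x, y). commutator x y \<bullet> commutator x y) x z y w"
    unfolding eq by (rule polarize_linear)
  also have "\<dots> = (2 + g) * (16 * (x \<bullet> z) * (y \<bullet> w) - 8 * ((x \<bullet> y) * (z \<bullet> w) + (x \<bullet> w) * (z \<bullet> y)))
     - 8 * (commutator x y \<bullet> commutator z w + commutator x w \<bullet> commutator z y)"
    unfolding polarize_norm_bilinear[OF bilinear_inner] polarize_norm_bilinear[OF bilinear_commutator]
      polarize_norm_mult
    unfolding inner_real_def ..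
  also have "\<dots> = 8 * ((2 + g) * (2 * (x \<bullet> z) * (y \<bullet> w) - ((x \<bullet> y) * (z \<bullet> w) + (x \<bullet> w) * (z \<bullet> y))))
    - 8 * (commutator x y \<bullet> commutator z w + commutator x w \<bullet> commutator z y)"
  proof -
    have "(2 + g) * (16 * a * b - 8 * c) - 8 * d = 8 * ((2 + g) * (2 * a * b - c)) - 8 * d" for a b c d
      by (simp add: algebra_simps)
    then show ?thesis .
  qed
  finally show ?thesis .
qed

text \<open>The polarized cycle sum is nonpositive on squares of alternating forms, and its value on
  the whole form is a negative multiple of \<open>2 * (2 + g) - (n + 2)\<close>.\<close>

lemma is_sos_BW_form_imp_ge:
  assumes n2: "CARD('n::finite) \<ge> 2"
    and sos: "is_sos (BW_form g :: (real ^ 'n ^ 'n) \<times> (real ^ 'n ^ 'n) \<Rightarrow> real)"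
  shows "(real CARD('n) - 2) / 2 \<le> g"
proof -
  let ?F = "BW_form g :: (real ^ 'n ^ 'n) \<times> (real ^ 'n ^ 'n) \<Rightarrow> real"
  let ?e = "sym_unit :: 'n \<Rightarrow> 'n \<Rightarrow> real ^ 'n ^ 'n"
  define n where "n = real CARD('n)"
  have hom: "?F (t *\<^sub>R x) = t ^ 4 * ?F x" for t x
  proof -
    have "commutator (t *\<^sub>R P) (t *\<^sub>R Q) = (t * t) *\<^sub>R commutator P Q" for P Q :: "real ^ 'n ^ 'n"
      by (simp add: scalar_matrix_assoc[symmetric] matrix_scalar_ac scaleR_diff_right)
    moreover have "(2 + g) * (t * (t * p) * (t * (t * q)) - (t * (t * r))\<^sup>2) - t * t * (t * t * c)
        = t ^ 4 * ((2 + g) * (p * q - r\<^sup>2) - c)" for p q r c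
      by (simp add: power2_eq_square eval_nat_numeral algebra_simps)
    ultimately show ?thesis
      by (cases x) (simp only: scaleR_Pair BW_form_eq inner_scaleR_left inner_scaleR_right)
  qed
  have zero: "?F (x, 0) = 0" "?F (0, x) = 0" "?F (x, x) = 0" for x
    by (simp_all add: BW_form_eq power2_eq_square)
  obtain bs where bs: "\<And>b. b \<in> set bs \<Longrightarrow> bilinear b" "\<And>b x. b \<in> set bs \<Longrightarrow> b x x = 0"
    and F: "\<And>x y. ?F (x, y) = (\<Sum>b\<leftarrow>bs. (b x y)\<^sup>2)"
    using sos_biquadratic_alternating[OF sos hom zero] by blast
  \<comment> \<open>Opposite edges of the 4-cycle \<open>i, k, j, l\<close> are paired in the same
    argument of the form.\<close>
  let ?sum4 = "\<lambda>f. \<Sum>i\<in>UNIV. \<Sum>j\<in>UNIV. \<Sum>k\<in>UNIV. \<Sum>l\<in>UNIV. f (?e i k) (?e j l) (?e k j) (?e l i) :: real"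
  have nonpos: "?sum4 (polarize (\<lambda>(x, y). \<Sum>b\<leftarrow>cs. (b x y)\<^sup>2)) \<le> 0" if "set cs \<subseteq> set bs" for cs
    using that
  proof (induction cs)
    case Nil
    then show ?case by (simp add: polarize_def)
  next
    case (Cons b cs)
    have "polarize (\<lambda>(x, y). \<Sum>b\<leftarrow>b # cs. (b x y)\<^sup>2) x z y w =
      polarize (\<lambda>(x, y). b x y \<bullet> b x y) x z y w + polarize (\<lambda>(x, y). \<Sum>b\<leftarrow>cs. (b x y)\<^sup>2) x z y w" for x y z w
      by (simp add: polarize_def power2_eq_square)
    then have "?sum4 (polarize (\<lambda>(x, y). \<Sum>b\<leftarrow>b # cs. (b x y)\<^sup>2))
      = ?sum4 (polarize (\<lambda>(x, y). b x y \<bullet> b x y)) + ?sum4 (polarize (\<lambda>(x, y). \<Sum>b\<leftarrow>cs. (b x y)\<^sup>2))"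
      by (simp only: sum.distrib)
    moreover have "?sum4 (polarize (\<lambda>(x, y). b x y \<bullet> b x y)) \<le> 0"
    proof -
      have b: "bilinear b" "\<And>x. b x x = 0" using Cons.prems bs by auto
      show ?thesis
        unfolding polarize_norm_bilinear[OF b(1)] sum_distrib_left[symmetric]
          sum_polarized_cycle[OF b sym_unit_commute]
        by (simp add: sum_nonneg)
    qed
    ultimately show ?case using Cons by simp
  qed
  have "?F = (\<lambda>(x, y). \<Sum>b\<leftarrow>bs. (b x y)\<^sup>2)"
    using F by auto
  then have "?sum4 (polarize ?F) \<le> 0"
    using nonpos[of bs] by simp
  \<comment> \<open>The polarization factor 8 and the factor -2 of the cycle identity make this -16
    times the sum of squared norms.\<close>
  also have "?sum4 (polarize ?F) = 8 * ((2 + g) * (- 8 * n * (n - 1) * (n + 2)))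
      - 8 * (- 2 * (2 * (n + 2)\<^sup>2 * n * (n - 1)))"
    unfolding polarize_BW_form sum_subtractf sum_distrib_left[symmetric] sum_inner_sym_unit_cycle[unfolded sum_subtractf]
      sum_polarized_cycle[OF bilinear_commutator diff_self sym_unit_commute] sum_norm_commutator_sym_unit[unfolded sum_subtractf] n_def ..
  also have "\<dots> = - ((32 * n * (n - 1) * (n + 2)) * (2 * (2 + g) - (n + 2)))"
    by algebra
  finally have "0 \<le> (32 * n * (n - 1) * (n + 2)) * (2 * (2 + g) - (n + 2))"
    by linarith
  moreover have "32 * n * (n - 1) * (n + 2) > 0"
    using n2 unfolding n_def by simp
  ultimately have "2 * (2 + g) - (n + 2) \<ge> 0"
    by (meson linorder_not_le mult_pos_neg)
  then show ?thesis
    unfolding n_def by simp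
qed

theorem theorem1:
  fixes \<gamma>\<^sub>n :: real
  assumes "CARD('n::finite) \<ge> 2"
    and "\<gamma>\<^sub>n = (real CARD('n) - 2) / 2"
  shows "is_sos (BW_form \<gamma>\<^sub>n :: (real ^ 'n ^ 'n) \<times> (real ^ 'n ^ 'n) \<Rightarrow> real) \<and>
    (\<forall>\<gamma>. is_sos (BW_form \<gamma> :: (real ^ 'n ^ 'n) \<times> (real ^ 'n ^ 'n) \<Rightarrow> real) \<longrightarrow> \<gamma>\<^sub>n \<le> \<gamma>)"
  using is_sos_BW_form[OF assms(1)] is_sos_BW_form_imp_ge[OF assms(1)] unfolding assms(2) by blast

end
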